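(* Let $\mathcal{A}$ be a Banach algebra such that $\mathrm{rad}(\mathcal{A})=\mathrm{rann}(\mathcal{A})$ and $\mathcal{A}/\mathrm{rad}(\mathcal{A})$ is commutative, and suppose $\mathcal{A}$ has a right identity. Let $d$ be a derivation of $\mathcal{A}$. Then the following are equivalent: (i) $d$ is an inner derivation; (ii) there exists $b_0\in\mathcal{A}$ such that for every $k\in\mathbb{N}$ the map $a\mapsto d(a)+b_0a$ is $k$-commuting; (iii) there exist $b_0\in\mathcal{A}$ and $k\in\mathbb{N}$ such that the map $a\mapsto d(a)+b_0a$ is $k$-commuting; (iv) there exist $b_0\in\mathcal{A}$ and $k\in\mathbb{N}$ such that the map $a\mapsto d(a)+b_0a$ is $k$-centralizing.
   Context: $\mathrm{rad}(\mathcal{A})$ is the Jacobson radical and $\mathrm{rann}(\mathcal{A})=\{c\in\mathcal{A}: ac=0\ \forall a\in\mathcal{A}\}$. A derivation is a linear map $d$ with $d(ab)=d(a)b+ad(b)$; it is inner if there is $b\in\mathcal{A}$ with $d(a)=ab-ba$ for all $a$. $Z(\mathcal{A})$ is the center, $[a,b]=ab-ba$. A map $T$ is $k$-centralizing (resp. $k$-commuting) if $[T(a),a^k]\in Z(\mathcal{A})$ (resp. $=0$) for all $a\in\mathcal{A}$. *)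

theory Defs
  imports "HOL-Analysis.Analysis"
begin

class complex_banach_algebra = real_normed_algebra + banach +
  fixes scaleC :: "complex \<Rightarrow> 'a \<Rightarrow> 'a"
  assumes scaleC_of_real: "scaleC (complex_of_real r) x = scaleR r x"
    and scaleC_add_left: "scaleC (c1 + c2) x = scaleC c1 x + scaleC c2 x"
    and scaleC_add_right: "scaleC c (x + y) = scaleC c x + scaleC c y"
    and scaleC_scaleC: "scaleC c1 (scaleC c2 x) = scaleC (c1 * c2) x"
    and norm_scaleC: "norm (scaleC c x) = cmod c * norm x"
    and scaleC_mult_left: "scaleC c x * y = scaleC c (x * y)"
    and scaleC_mult_right: "x * scaleC c y = scaleC c (x * y)"

definition quasi_invertible :: "'a::ring \<Rightarrow> bool" where
  "quasi_invertible x \<longleftrightarrow> (\<exists>y. x + y - x * y = 0 \<and> y + x - y * x = 0)"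

definition jacobson_rad :: "'a::ring set" where
  "jacobson_rad = {a. \<forall>b. quasi_invertible (b * a)}"

definition rann :: "'a::ring set" where
  "rann = {c. \<forall>a. a * c = 0}"

definition center :: "'a::ring set" where
  "center = {z. \<forall>a. z * a = a * z}"

definition commutator :: "'a::ring \<Rightarrow> 'a \<Rightarrow> 'a" where
  "commutator a b = a * b - b * a"

text \<open>Positive powers in a possibly non-unital algebra: pow1 a n = a^(n+1).\<close>
primrec pow1 :: "'a::ring \<Rightarrow> nat \<Rightarrow> 'a" where
  "pow1 a 0 = a"
| "pow1 a (Suc n) = a * pow1 a n"

definition cderivation :: "('a::complex_banach_algebra \<Rightarrow> 'a) \<Rightarrow> bool" where
  "cderivation d \<longleftrightarrow> (\<forall>x y. d (x + y) = d x + d y) \<and> (\<forall>c x. d (scaleC c x) = scaleC c (d x))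
     \<and> (\<forall>a b. d (a * b) = d a * b + a * d b)"

definition inner_derivation :: "('a::ring \<Rightarrow> 'a) \<Rightarrow> bool" where
  "inner_derivation d \<longleftrightarrow> (\<exists>b. \<forall>a. d a = a * b - b * a)"

text \<open>k-commuting / k-centralizing for k \<ge> 1 (a^k = pow1 a (k - 1)).\<close>
definition k_commuting :: "nat \<Rightarrow> ('a::ring \<Rightarrow> 'a) \<Rightarrow> bool" where
  "k_commuting k T \<longleftrightarrow> (\<forall>a. commutator (T a) (pow1 a (k - 1)) = 0)"

definition k_centralizing :: "nat \<Rightarrow> ('a::ring \<Rightarrow> 'a) \<Rightarrow> bool" where
  "k_centralizing k T \<longleftrightarrow> (\<forall>a. commutator (T a) (pow1 a (k - 1)) \<in> center)"

end

theory Submission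
  imports Defs "HOL-Computational_Algebra.Fundamental_Theorem_Algebra"
begin

text \<open>
  Let \<open>R\<close> be the right annihilator. As commutators lie in \<open>R\<close>, we have \<open>x a b = x b a\<close>, and for
  \<open>d a = a b - b a\<close> the map \<open>d a + b a = a b\<close> commutes with all powers of \<open>a\<close>. Conversely, let
  \<open>d a + b\<^sub>0 a\<close> be \<open>k\<close>-centralizing and put \<open>\<delta> a = d a - (a b\<^sub>0 - b\<^sub>0 a)\<close>. Since \<open>R\<close> meets the
  center trivially, \<open>\<delta> a\<close> commutes with \<open>a ^ k\<close>; testing this on the idempotents \<open>e\<close> and \<open>e + c\<close>,
  where \<open>e\<close> is a right identity and \<open>c\<close> is in \<open>R\<close>, shows that \<open>\<delta>\<close> vanishes at \<open>e\<close> and on \<open>R\<close>.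
  Hence \<open>\<delta>\<close> restricts to the commutative semisimple Banach algebra \<open>e A\<close>, a complement of \<open>R\<close>,
  where it is \<open>0\<close> by a theorem of Johnson.

  Johnson's theorem is proved without characters. A gliding hump argument shows that every element
  \<open>y\<close> of the separating space \<open>S\<close> of a derivation \<open>D\<close> has finite spectrum. By semisimplicity \<open>y\<close>
  is then annihilated by a polynomial \<open>p\<close> with simple roots, and \<open>p' y * D y = 0\<close> with \<open>p' y\<close>
  invertible gives \<open>D y = 0\<close>. As \<open>S\<close> is an ideal, it follows that \<open>y * D x = 0\<close> for all \<open>x\<close>, so
  \<open>y * y = 0\<close> and \<open>y = 0\<close>. Therefore \<open>D\<close> is continuous, and the Kleinecke-Shirokov argument shows
  that its values are quasinilpotent.
\<close>

section \<open>Invertibility and spectra in commutative unital Banach algebras\<close>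

text \<open>The identity may have norm greater than 1, as idempotents can; hence the factors
  \<open>norm 1\<close> in the estimates below. Invertibility is written as divisibility of
  1.\<close>

class comm_unital_banach_algebra = complex_banach_algebra + comm_ring_1

definition scal :: "complex \<Rightarrow> 'a::comm_unital_banach_algebra" where
  "scal c = scaleC c 1"

lemma scal_mult_left: "scal c * x = scaleC c x"
  by (simp add: scal_def scaleC_mult_left)

lemma norm_scal_mult: "norm (scal c * x) = cmod c * norm x"
  by (simp add: scal_mult_left norm_scaleC)

lemma scal_of_real_mult: "scal (complex_of_real r) * x = r *\<^sub>R x"
  by (simp add: scal_mult_left scaleC_of_real)

lemma scal_add: "scal (b + c) = scal b + scal c"
  by (simp add: scal_def scaleC_add_left)

lemma scal_mult: "scal (b * c) = scal b * scal c"
  by (metis scal_def scal_mult_left scaleC_scaleC)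

lemma scal_1 [simp]: "scal 1 = 1"
  using scal_of_real_mult[of 1 "1::'a"] by simp

lemma scal_0 [simp]: "scal 0 = 0"
  using scal_add[of 0 0] by simp

lemma scal_minus: "scal (- c) = - scal c"
  using scal_add[of c "- c"] by (simp add: eq_neg_iff_add_eq_0 add.commute)

lemma scal_diff: "scal (b - c) = scal b - scal c"
  using scal_add[of b "- c"] by (simp add: scal_minus)

lemma scal_power: "scal (c ^ n) = scal c ^ n"
  by (induction n) (auto simp: scal_mult)

lemma scal_sum: "scal (sum f F) = (\<Sum>i\<in>F. scal (f i))"
  by (induction F rule: infinite_finite_induct) (auto simp: scal_add)

lemma scal_dvd_one: "c \<noteq> 0 \<Longrightarrow> scal c dvd 1"
  by (metis dvd_def right_inverse scal_1 scal_mult)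

lemma norm_power_mult_le:
  fixes x y :: "'a::comm_unital_banach_algebra"
  shows "norm (x ^ n * y) \<le> norm x ^ n * norm y"
proof (induction n)
  case (Suc n)
  have "norm (x ^ Suc n * y) \<le> norm x * norm (x ^ n * y)"
    by (metis mult.assoc norm_mult_ineq power_Suc)
  also have "\<dots> \<le> norm x * (norm x ^ n * norm y)"
    by (intro mult_left_mono Suc) auto
  finally show ?case by (simp add: mult.assoc)
qed simp

text \<open>Neumann series: multiplied by \<open>1 - h\<close>, its partial sums telescope to
  \<open>1 - h ^ n\<close>.\<close>

lemma one_minus_dvd_one:
  fixes h :: "'a::comm_unital_banach_algebra"
  assumes "norm h < 1"
  shows "(1 - h) dvd 1"
proof -
  have le: "norm (h ^ n) \<le> norm (1::'a) * norm h ^ n" for n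
    using norm_power_mult_le[of h n 1] by (simp add: mult.commute)
  have "summable (\<lambda>n. norm (1::'a) * norm h ^ n)"
    using assms by (intro summable_mult summable_geometric) auto
  then have sm: "summable (\<lambda>n. h ^ n)"
    by (rule summable_comparison_test') (use le in auto)
  then have "(\<lambda>n. (1 - h) * (\<Sum>k<n. h ^ k)) \<longlonglongrightarrow> (1 - h) * suminf (\<lambda>n. h ^ n)"
    by (intro tendsto_intros summable_LIMSEQ)
  moreover have "(\<lambda>n. (1 - h) * (\<Sum>k<n. h ^ k)) \<longlonglongrightarrow> 1 - 0"
    unfolding one_diff_power_eq[symmetric]
    by (intro tendsto_intros summable_LIMSEQ_zero sm)
  ultimately have "(1 - h) * suminf (\<lambda>n. h ^ n) = 1"
    using LIMSEQ_unique by fastforce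
  then show ?thesis
    by (metis dvd_triv_left)
qed

lemma one_minus_dvd_one_of_power:
  fixes x :: "'a::comm_unital_banach_algebra"
  assumes "norm (x ^ n) < 1"
  shows "(1 - x) dvd 1"
  by (metis assms dvd_trans dvd_triv_left one_diff_power_eq one_minus_dvd_one)

text \<open>Spectral radius 0, with an arbitrary factor \<open>r ^ n\<close> in place of
  \<open>n\<close>-th roots of norms.\<close>

definition quasinilpotent :: "'a::comm_unital_banach_algebra \<Rightarrow> bool" where
  "quasinilpotent q \<longleftrightarrow> (\<forall>r\<ge>0. (\<lambda>n. r ^ n * norm (q ^ n)) \<longlonglongrightarrow> 0)"

lemma quasinilpotent_one_minus_mult_dvd_one:
  fixes q :: "'a::comm_unital_banach_algebra"
  assumes "quasinilpotent q"
  shows "(1 - b * q) dvd 1"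
proof -
  have "(\<lambda>n. norm b ^ n * norm (q ^ n)) \<longlonglongrightarrow> 0"
    using assms by (auto simp: quasinilpotent_def)
  then have "\<forall>\<^sub>F n in sequentially. norm b ^ n * norm (q ^ n) < 1"
    by (rule order_tendstoD) simp
  then obtain n where n: "norm b ^ n * norm (q ^ n) < 1"
    by (auto simp: eventually_sequentially)
  have "norm ((b * q) ^ n) \<le> norm b ^ n * norm (q ^ n)"
    unfolding power_mult_distrib by (rule norm_power_mult_le)
  with n show ?thesis
    by (intro one_minus_dvd_one_of_power[of _ n]) auto
qed

section \<open>Elements without nonzero spectrum are quasinilpotent\<close>

lemma sum_roots_of_unity_powers:
  assumes "k < n" "k \<noteq> 0"
  shows "(\<Sum>j<n. (cis (2 * pi / n) ^ j) ^ k) = 0"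
proof -
  define w where "w = cis (2 * pi / n) ^ k"
  have w: "w = cis (2 * pi * (k / n))"
    by (simp add: w_def Complex.DeMoivre mult_ac)
  have "w \<noteq> 1"
  proof
    assume "w = 1"
    then have "cos (2 * pi * (k / n)) = 1"
      by (simp add: w complex_eq_iff)
    then obtain i :: int where "2 * pi * (k / n) = i * 2 * pi"
      by (auto simp: cos_one_2pi_int)
    then have "2 * pi * (k / n - of_int i) = 0"
      by (simp add: algebra_simps)
    then have "real k / real n = of_int i" by simp
    moreover have "0 < real k / real n" "real k / real n < 1"
      using assms by auto
    ultimately show False by simp
  qed
  moreover have "w ^ n = 1"
    using assms by (simp add: w_def power_mult[symmetric] mult.commute[of k])
      (simp add: power_mult Complex.DeMoivre)
  ultimately have "(\<Sum>j<n. w ^ j) = 0"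
    by (simp add: geometric_sum)
  then show ?thesis
    by (simp add: w_def power_mult[symmetric] mult.commute)
qed

text \<open>Averaging the resolvent over the \<open>n\<close>-th roots of unity gives the inverse of
  \<open>1 - c ^ n q ^ n\<close>. Since the bound and the Lipschitz constant of the resolvent on a disc pass
  to these averages uniformly in \<open>n\<close>, the convergence \<open>r ^ n q ^ n \<longlonglongrightarrow> 0\<close> can be propagated to
  larger radii in steps of fixed length. This replaces Cauchy's formula for vector-valued
  functions.\<close>

lemma average_of_resolvent:
  fixes q :: "'a::comm_unital_banach_algebra"
  assumes R: "\<And>c. (1 - scal c * q) * R c = 1" and "n > 0"
  shows "(1 - scal (c ^ n) * q ^ n) *
    (scal (1 / of_nat n) * (\<Sum>j<n. R (cis (2 * pi / n) ^ j * c))) = 1"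
proof -
  define w where "w = cis (2 * pi / n)"
  have wn: "w ^ n = 1"
    using \<open>n > 0\<close> by (simp add: w_def Complex.DeMoivre)
  \<comment> \<open>\<open>w ^ j * c\<close> and \<open>c\<close> have the same \<open>n\<close>-th
    power, so \<open>1 - c ^ n q ^ n\<close> contains the factor \<open>1 - w ^ j c q\<close>, which
    \<open>R\<close> cancels. A geometric sum is left, of which summation over \<open>j\<close>
    keeps only the term \<open>k = 0\<close>.\<close>
  have *: "(1 - scal (c ^ n) * q ^ n) * R (w ^ j * c)
      = (\<Sum>k<n. scal (c ^ k) * q ^ k * scal ((w ^ j) ^ k))" for j
  proof -
    have sp: "(scal z * q) ^ k = scal (z ^ k) * q ^ k" for z k
      by (simp add: power_mult_distrib scal_power)
    have "(w ^ j) ^ n = (w ^ n) ^ j"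
      by (metis power_mult mult.commute)
    then have "(w ^ j * c) ^ n = c ^ n"
      by (simp add: power_mult_distrib wn)
    then have "1 - scal (c ^ n) * q ^ n = 1 - (scal (w ^ j * c) * q) ^ n"
      by (simp only: sp)
    also have "\<dots> = (1 - scal (w ^ j * c) * q) * (\<Sum>k<n. (scal (w ^ j * c) * q) ^ k)"
      by (rule one_diff_power_eq)
    finally have "(1 - scal (c ^ n) * q ^ n) * R (w ^ j * c)
        = ((1 - scal (w ^ j * c) * q) * R (w ^ j * c)) * (\<Sum>k<n. (scal (w ^ j * c) * q) ^ k)"
      by (simp only: mult_ac)
    then show ?thesis
      unfolding R sp by (simp add: power_mult_distrib scal_mult mult_ac)
  qed
  have "(1 - scal (c ^ n) * q ^ n) * (\<Sum>j<n. R (w ^ j * c))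
      = (\<Sum>j<n. \<Sum>k<n. scal (c ^ k) * q ^ k * scal ((w ^ j) ^ k))"
    by (simp add: sum_distrib_left *)
  also have "\<dots> = (\<Sum>k<n. scal (c ^ k) * q ^ k * scal (\<Sum>j<n. (w ^ j) ^ k))"
    by (subst sum.swap) (simp add: sum_distrib_left scal_sum)
  also have "\<dots> = (\<Sum>k<n. if k = 0 then scal (of_nat n) else 0)"
    by (intro sum.cong) (auto simp: w_def sum_roots_of_unity_powers)
  also have "\<dots> = scal (of_nat n)"
    using \<open>n > 0\<close> by simp
  finally have "(1 - scal (c ^ n) * q ^ n) * (scal (1 / of_nat n) * (\<Sum>j<n. R (w ^ j * c)))
     = scal (1 / of_nat n) * scal (of_nat n)"
    by (metis mult.left_commute)
  then show ?thesis
    using \<open>n > 0\<close> by (simp add: w_def flip: scal_mult)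
qed

lemma resolvent_diff:
  fixes q :: "'a::comm_unital_banach_algebra"
  assumes R: "\<And>c. (1 - scal c * q) * R c = 1"
  shows "R b - R c = scal (b - c) * (q * R b * R c)"
proof -
  have "R b - R c = ((1 - scal c * q) * R c) * R b - ((1 - scal b * q) * R b) * R c"
    by (simp add: R)
  also have "\<dots> = scal (b - c) * (q * R b * R c)"
    by (simp add: scal_diff algebra_simps)
  finally show ?thesis .
qed

lemma continuous_on_resolvent:
  fixes q :: "'a::comm_unital_banach_algebra"
  assumes R: "\<And>c. (1 - scal c * q) * R c = 1"
  shows "continuous_on UNIV R"
proof -
  have "isCont R b" for b
  proof -
    define K where "K = norm (q * R b)"
    \<comment> \<open>No bound on \<open>R c\<close> is known beforehand. Near \<open>b\<close> the
      resolvent identity gives \<open>norm (R c) \<le> 2 * norm (R b)\<close> by absorbing half of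
      \<open>norm (R c)\<close>.\<close>
    have bd: "norm (R c - R b) \<le> cmod (c - b) * (K * (2 * norm (R b)))"
      if c: "cmod (c - b) * K \<le> 1 / 2" for c
    proof -
      have le: "norm (R c - R b) \<le> cmod (c - b) * (K * norm (R c))"
        unfolding resolvent_diff[OF R] norm_scal_mult K_def
        by (intro mult_left_mono) (metis mult.assoc mult.commute norm_mult_ineq, auto)
      have "cmod (c - b) * (K * norm (R c)) \<le> 1 / 2 * norm (R c)"
        using mult_right_mono[OF c, of "norm (R c)"] by (simp add: mult.assoc)
      then have "norm (R c) \<le> 2 * norm (R b)"
        using le norm_triangle_ineq2[of "R c" "R b"] by linarith
      then have "cmod (c - b) * (K * norm (R c)) \<le> cmod (c - b) * (K * (2 * norm (R b)))"
        by (intro mult_left_mono) (auto simp: K_def)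
      with le show ?thesis by linarith
    qed
    have "((\<lambda>c. cmod (c - b) * K) \<longlongrightarrow> cmod (b - b) * K) (at b)"
      by (intro tendsto_intros)
    then have "\<forall>\<^sub>F c in at b. cmod (c - b) * K < 1 / 2"
      by (rule order_tendstoD) auto
    then have ev: "\<forall>\<^sub>F c in at b. norm (R c - R b) \<le> cmod (c - b) * (K * (2 * norm (R b)))"
      by eventually_elim (use bd in auto)
    have "((\<lambda>c. cmod (c - b) * (K * (2 * norm (R b)))) \<longlongrightarrow> cmod (b - b) * (K * (2 * norm (R b)))) (at b)"
      by (intro tendsto_intros)
    then have "((\<lambda>c. R c - R b) \<longlongrightarrow> 0) (at b)"
      by (intro Lim_null_comparison[OF ev]) simp
    then show ?thesis
      by (simp add: isCont_def LIM_zero_iff)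
  qed
  then show ?thesis
    by (simp add: continuous_at_imp_continuous_on)
qed

lemma quasinilpotent_if_no_nonzero_spectrum:
  fixes q :: "'a::comm_unital_banach_algebra"
  assumes inv: "\<And>c. (1 - scal c * q) dvd 1"
  shows "quasinilpotent q"
  unfolding quasinilpotent_def
proof (intro allI impI)
  fix r :: real assume "r \<ge> 0"
  obtain R where R: "\<And>c. (1 - scal c * q) * R c = 1"
    using inv unfolding dvd_def by metis
  have "compact (R ` cball 0 (r + 1))"
    by (intro compact_continuous_image continuous_on_subset[OF continuous_on_resolvent[OF R]]) auto
  then obtain M where M: "M > 0" "\<And>c. cmod c \<le> r + 1 \<Longrightarrow> norm (R c) \<le> M"
    by (metis bounded_pos compact_imp_bounded image_eqI mem_cball_0)
  define L where "L = norm q * M * M"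
  have L: "norm (R b - R c) \<le> L * cmod (b - c)" if "cmod b \<le> r + 1" "cmod c \<le> r + 1" for b c
  proof -
    have "norm (q * R b * R c) \<le> norm (q * R b) * norm (R c)"
      by (rule norm_mult_ineq)
    also have "\<dots> \<le> norm q * norm (R b) * norm (R c)"
      by (intro mult_right_mono norm_mult_ineq) auto
    also have "\<dots> \<le> L"
      unfolding L_def using M that by (intro mult_mono) auto
    finally show ?thesis
      unfolding resolvent_diff[OF R] norm_scal_mult
      by (metis mult.commute mult_left_mono norm_ge_zero)
  qed
  define G where "G n c = scal (1 / of_nat n) * (\<Sum>j<n. R (cis (2 * pi / n) ^ j * c))" for n c
  have norm_avg: "norm (scal (1 / of_nat n) * (\<Sum>j<n. f j)) \<le> B"
    if "n > 0" "\<And>j. j < n \<Longrightarrow> norm (f j) \<le> B" for n B and f :: "nat \<Rightarrow> 'a"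
  proof -
    have "norm (\<Sum>j<n. f j) \<le> of_nat n * B"
      using sum_norm_bound[of "{..<n}" f B] that by simp
    then show ?thesis
      using \<open>n > 0\<close> unfolding norm_scal_mult by (simp add: norm_divide divide_simps mult.commute)
  qed
  have G1: "(1 - scal (c ^ n) * q ^ n) * G n c = 1" if "n > 0" for n c
    unfolding G_def by (rule average_of_resolvent[OF R that])
  have GM: "norm (G n c) \<le> M" if "n > 0" "cmod c \<le> r + 1" for n c
    unfolding G_def using that M by (intro norm_avg) (auto simp: norm_mult norm_power)
  have GL: "norm (G n b - G n c) \<le> L * cmod (b - c)"
    if "n > 0" "cmod b \<le> r + 1" "cmod c \<le> r + 1" for n b c
  proof -
    have "norm (R (cis (2 * pi / n) ^ j * b) - R (cis (2 * pi / n) ^ j * c)) \<le> L * cmod (b - c)" for j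
      using L[of "cis (2 * pi / n) ^ j * b" "cis (2 * pi / n) ^ j * c"] that
      by (simp add: norm_mult norm_power flip: right_diff_distrib)
    then show ?thesis
      unfolding G_def right_diff_distrib[symmetric] sum_subtractf[symmetric]
      using that by (intro norm_avg) auto
  qed
  define Z where "Z s \<longleftrightarrow> (\<lambda>n. s ^ n * norm (q ^ n)) \<longlonglongrightarrow> 0" for s :: real
  \<comment> \<open>If \<open>Z s\<close> holds, \<open>G n s\<close> is eventually within 1/4 of 1,
    and the Lipschitz bound puts \<open>G n u\<close> within 1/2 of 1. As \<open>G n u\<close>
    inverts \<open>1 - u ^ n q ^ n\<close>, it follows that
    \<open>u ^ n * norm (q ^ n) \<le> 1\<close>, hence geometric decay for
    \<open>t < u\<close>.\<close>
  have step: "Z t" if s: "Z s" "0 \<le> s" "s < t" and u: "t < u" "u \<le> r + 1" "L * (u - s) \<le> 1 / 4" for s t u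
  proof -
    have nsc: "norm (scal (of_real x ^ n) * q ^ n) = x ^ n * norm (q ^ n)" if "x \<ge> 0" for x n
      using that by (simp add: norm_scal_mult norm_power)
    have "\<forall>\<^sub>F n in sequentially. s ^ n * norm (q ^ n) < 1 / (4 * M)"
      using s(1) M(1) unfolding Z_def by (intro order_tendstoD) auto
    then have "\<forall>\<^sub>F n in sequentially. u ^ n * norm (q ^ n) \<le> 1"
      using eventually_gt_at_top[of 0]
    proof eventually_elim
      case (elim n)
      define h where "h = scal (of_real s ^ n) * q ^ n"
      define k where "k = scal (of_real u ^ n) * q ^ n"
      define g where "g = G n (of_real u) - 1"
      have "G n (of_real s) - 1 = h * G n (of_real s)"
        using G1[of n "of_real s"] elim by (simp add: h_def algebra_simps)
      then have "norm (G n (of_real s) - 1) \<le> norm h * norm (G n (of_real s))"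
        by (simp add: norm_mult_ineq)
      also have "\<dots> \<le> 1 / (4 * M) * M"
        using elim GM[of n "of_real s"] s u M by (intro mult_mono) (auto simp: h_def nsc)
      finally have 1: "norm (G n (of_real s) - 1) \<le> 1 / 4"
        using M by simp
      have "norm (G n (of_real u) - G n (of_real s)) \<le> L * cmod (of_real u - of_real s)"
        using elim s u by (intro GL) auto
      also have "\<dots> = L * (u - s)"
        using s u by (simp flip: of_real_diff)
      finally have 2: "norm (G n (of_real u) - G n (of_real s)) \<le> 1 / 4"
        using u by linarith
      have g: "norm g \<le> 1 / 2"
        using 1 2 norm_triangle_ineq[of "G n (of_real u) - G n (of_real s)" "G n (of_real s) - 1"]
        by (simp add: g_def)
      have "k = g - k * g"
        using G1[of n "of_real u"] elim by (simp add: k_def g_def algebra_simps)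
      then have "norm k \<le> norm g + norm (k * g)"
        by (metis norm_triangle_ineq4)
      also have "\<dots> \<le> 1 / 2 + norm k * (1 / 2)"
        using g by (intro add_mono order_trans[OF norm_mult_ineq] mult_left_mono) auto
      finally have "norm k \<le> 1" by simp
      then show ?case
        using s u by (simp add: k_def nsc)
    qed
    then have "\<forall>\<^sub>F n in sequentially. norm (t ^ n * norm (q ^ n)) \<le> (t / u) ^ n"
    proof eventually_elim
      case (elim n)
      have "t ^ n * norm (q ^ n) = (t / u) ^ n * (u ^ n * norm (q ^ n))"
        using s u by (simp add: power_divide)
      also have "\<dots> \<le> (t / u) ^ n * 1"
        using s u elim by (intro mult_left_mono) auto
      finally show ?case using s u by (simp add: abs_mult)
    qed
    moreover have "(\<lambda>n. (t / u) ^ n) \<longlonglongrightarrow> 0"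
      using s u by (intro LIMSEQ_realpow_zero) auto
    ultimately show ?thesis
      unfolding Z_def by (rule Lim_null_comparison)
  qed
  have Lpos: "L \<ge> 0" using M by (simp add: L_def)
  obtain N :: nat where N: "8 * (L + 1) * (r + 1) < N"
    using reals_Archimedean2 by blast
  \<comment> \<open>A step leads from \<open>n \<delta>\<close> to \<open>(n + 1) \<delta>\<close>
    with \<open>u = (n + 2) \<delta>\<close>, whence the bound on \<open>2 * \<delta>\<close>. Since
    \<open>u \<le> r + 1 = N \<delta>\<close> is required, the steps end at
    \<open>(N - 1) \<delta> = r + 1 - \<delta>\<close>, which still exceeds
    \<open>r\<close>.\<close>
  define \<delta> where "\<delta> = (r + 1) / N"
  have Npos: "N > 0"
  proof (rule ccontr)
    assume "\<not> N > 0"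
    moreover have "0 \<le> 8 * (L + 1) * (r + 1)" using Lpos \<open>r \<ge> 0\<close> by simp
    ultimately show False using N by simp
  qed
  have \<delta>: "\<delta> > 0" "L * (2 * \<delta>) \<le> 1 / 4" "\<delta> \<le> 1 / 2"
  proof -
    show d0: "\<delta> > 0" using Npos \<open>r \<ge> 0\<close> by (simp add: \<delta>_def)
    have 8: "8 * (L + 1) * \<delta> \<le> 1"
      using N Npos by (simp add: \<delta>_def divide_simps)
    have "8 * L * \<delta> \<ge> 0" using Lpos d0 by simp
    then show "\<delta> \<le> 1 / 2" "L * (2 * \<delta>) \<le> 1 / 4"
      using 8 d0 by (simp_all add: algebra_simps)
  qed
  have "Suc n \<le> N \<Longrightarrow> Z (real n * \<delta>)" for n
  proof (induction n)
    case 0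
    have "\<forall>\<^sub>F n in sequentially. (0::real) ^ n * norm (q ^ n) = 0"
      using eventually_gt_at_top[of 0] by eventually_elim auto
    then show ?case by (simp add: Z_def tendsto_eventually)
  next
    case (Suc n)
    have "real (Suc (Suc n)) * \<delta> \<le> real N * \<delta>"
      using Suc.prems \<delta> by (intro mult_right_mono) auto
    also have "\<dots> = r + 1" using Npos by (simp add: \<delta>_def)
    finally have u: "real (Suc (Suc n)) * \<delta> \<le> r + 1" .
    have e: "real (Suc (Suc n)) * \<delta> - real n * \<delta> = 2 * \<delta>"
      by (simp add: distrib_right)
    show ?case
      by (rule step[of "real n * \<delta>" _ "real (Suc (Suc n)) * \<delta>"])
        (use Suc \<delta> u e in \<open>simp_all add: distrib_right\<close>)
  qed
  from this[of "N - 1"] have "Z (real (N - 1) * \<delta>)"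
    using Npos by simp
  moreover have "real (N - 1) * \<delta> = r + 1 - \<delta>"
    using Npos by (simp add: of_nat_diff algebra_simps) (simp add: \<delta>_def)
  moreover have "Z r" if "Z t" "r \<le> t" for t
    unfolding Z_def
  proof (rule Lim_null_comparison[OF _ that(1)[unfolded Z_def]], rule always_eventually, rule allI)
    fix n show "norm (r ^ n * norm (q ^ n)) \<le> t ^ n * norm (q ^ n)"
      using that \<open>r \<ge> 0\<close> by (simp add: abs_mult mult_right_mono power_mono)
  qed
  ultimately have "Z r" using \<delta> by fastforce
  then show "(\<lambda>n. r ^ n * norm (q ^ n)) \<longlonglongrightarrow> 0" by (simp add: Z_def)
qed

section \<open>The separating space of a linear map\<close>

text \<open>The limits of \<open>D (x n)\<close> along sequences \<open>x n\<close> tending to 0.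
  For linear \<open>D\<close> between Banach spaces, continuity means that 0 is the only
  one.\<close>

definition separating_space :: "('a::real_normed_vector \<Rightarrow> 'b::real_normed_vector) \<Rightarrow> 'b set" where
  "separating_space D = {y. \<forall>\<epsilon>>0. \<exists>x. norm x < \<epsilon> \<and> norm (D x - y) < \<epsilon>}"

lemma separating_spaceE:
  assumes "y \<in> separating_space D" "\<epsilon> > 0"
  obtains x where "norm x < \<epsilon>" "norm (D x - y) < \<epsilon>"
  using assms unfolding separating_space_def by blast

lemma subspace_separating_space:
  assumes "linear D"
  shows "subspace (separating_space D)"
proof (rule subspaceI)
  interpret linear D by fact
  show "0 \<in> separating_space D"
    unfolding separating_space_def by (auto intro: exI[of _ 0])
  show "x + y \<in> separating_space D" if x: "x \<in> separating_space D" and y: "y \<in> separating_space D" for x y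
    unfolding separating_space_def
  proof (intro CollectI allI impI)
    fix \<epsilon> :: real assume "\<epsilon> > 0"
    then have "\<epsilon> / 2 > 0" by simp
    obtain u where u: "norm u < \<epsilon> / 2" "norm (D u - x) < \<epsilon> / 2"
      using separating_spaceE[OF x \<open>\<epsilon> / 2 > 0\<close>] .
    obtain v where v: "norm v < \<epsilon> / 2" "norm (D v - y) < \<epsilon> / 2"
      using separating_spaceE[OF y \<open>\<epsilon> / 2 > 0\<close>] .
    from u v have "norm (u + v) < \<epsilon> \<and> norm (D (u + v) - (x + y)) < \<epsilon>"
      using norm_triangle_ineq[of u v] norm_triangle_ineq[of "D u - x" "D v - y"]
      by (simp add: add algebra_simps)
    then show "\<exists>z. norm z < \<epsilon> \<and> norm (D z - (x + y)) < \<epsilon>" by blast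
  qed
  show "c *\<^sub>R x \<in> separating_space D" if "x \<in> separating_space D" for c x
    unfolding separating_space_def
  proof (intro CollectI allI impI)
    fix \<epsilon> :: real assume "\<epsilon> > 0"
    then have "\<epsilon> / (\<bar>c\<bar> + 1) > 0" by simp
    with that obtain u where "norm u < \<epsilon> / (\<bar>c\<bar> + 1)" "norm (D u - x) < \<epsilon> / (\<bar>c\<bar> + 1)"
      by (rule separating_spaceE)
    then have *: "norm u * (\<bar>c\<bar> + 1) < \<epsilon>" "norm (D u - x) * (\<bar>c\<bar> + 1) < \<epsilon>"
      by (simp_all add: pos_less_divide_eq)
    have "norm (c *\<^sub>R u) \<le> norm u * (\<bar>c\<bar> + 1)"
         "norm (c *\<^sub>R (D u - x)) \<le> norm (D u - x) * (\<bar>c\<bar> + 1)"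
      unfolding norm_scaleR by (simp_all add: algebra_simps)
    with * have "norm (c *\<^sub>R u) < \<epsilon> \<and> norm (D (c *\<^sub>R u) - c *\<^sub>R x) < \<epsilon>"
      by (simp add: scale scaleR_diff_right)
    then show "\<exists>z. norm z < \<epsilon> \<and> norm (D z - c *\<^sub>R x) < \<epsilon>" by blast
  qed
qed

lemma Baire_ball_subset_closure:
  fixes U :: "nat \<Rightarrow> 'a::banach set"
  assumes "(\<Union>k. U k) = UNIV"
  obtains k x r where "r > 0" "ball x r \<subseteq> closure (U k)"
proof -
  have mc: "Met_TC.mcomplete TYPE('a)"
    by (simp add: mcomplete_iff_complete complete_UNIV)
  have "\<exists>k. interior (closure (U k)) \<noteq> {}"
  proof (rule ccontr)
    assume "\<nexists>k. interior (closure (U k)) \<noteq> {}"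
    then have "interior (\<Union> (range (\<lambda>k. closure (U k)))) = {}"
      using Met_TC.metric_Baire_category_alt[OF mc, of "range (\<lambda>k. closure (U k))"] by auto
    moreover have "\<Union> (range (\<lambda>k. closure (U k))) = UNIV"
    proof -
      have "(\<Union>k. U k) \<subseteq> (\<Union>k. closure (U k))"
        by (intro UN_mono closure_subset) simp
      then show ?thesis
        unfolding assms by (rule top.extremum_uniqueI)
    qed
    ultimately have "interior (UNIV :: 'a set) = {}" by metis
    then show False by simp
  qed
  then obtain k x where "x \<in> interior (closure (U k))" by blast
  then show thesis using that by (meson mem_interior)
qed

text \<open>The closed graph theorem for the map induced into the quotient by the separating space.\<close>

lemma separating_space_approximation:
  fixes D :: "'a::banach \<Rightarrow> 'b::banach"
  assumes "linear D"
  obtains C where "C \<ge> 0" "\<And>x. \<exists>s\<in>separating_space D. norm (D x - s) \<le> C * norm x"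
proof -
  interpret linear D by fact
  define S where "S = separating_space D"
  have S: "subspace S" unfolding S_def by (rule subspace_separating_space) fact
  define U where "U k = {x. \<exists>s\<in>S. norm (D x - s) \<le> real k}" for k
  have "x \<in> U (nat \<lceil>norm (D x)\<rceil>)" for x
    unfolding U_def using S by (auto intro!: bexI[of _ 0] simp: subspace_0 real_nat_ceiling_ge)
  then have "(\<Union>k. U k) = UNIV" by blast
  then obtain k a r where r: "r > 0" "ball a r \<subseteq> closure (U k)"
    by (rule Baire_ball_subset_closure)
  \<comment> \<open>Subtracting approximants of \<open>a + x\<close> and \<open>a\<close> in
    \<open>U k\<close> moves the ball to the origin and doubles the bound.\<close>
  have near: "\<exists>u. (\<exists>s\<in>S. norm (D u - s) \<le> 2 * real k) \<and> norm (x - u) < \<epsilon>"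
    if x: "norm x < r" and "\<epsilon> > 0" for x \<epsilon>
  proof -
    have "a + x \<in> closure (U k)" "a \<in> closure (U k)"
      using x r by (auto simp: dist_norm)
    then obtain u v where u: "u \<in> U k" "dist u (a + x) < \<epsilon> / 2" and v: "v \<in> U k" "dist v a < \<epsilon> / 2"
      using \<open>\<epsilon> > 0\<close> by (meson closure_approachable half_gt_zero)
    obtain s t where s: "s \<in> S" "norm (D u - s) \<le> k" "t \<in> S" "norm (D v - t) \<le> k"
      using u v by (auto simp: U_def)
    have "norm (D (u - v) - (s - t)) \<le> norm (D u - s) + norm (D v - t)"
      using norm_triangle_ineq4[of "D u - s" "D v - t"] by (simp add: diff algebra_simps)
    then have "norm (D (u - v) - (s - t)) \<le> 2 * real k" "s - t \<in> S"
      using s S by (auto intro: subspace_diff)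
    moreover have "norm (x - (u - v)) < \<epsilon>"
      using norm_triangle_ineq4[of "v - a" "u - (a + x)"] u v
      by (simp add: dist_norm algebra_simps)
    ultimately show ?thesis by blast
  qed
  define K where "K = 4 * real k / r"
  have near': "\<exists>u s. s \<in> S \<and> norm (D u - s) \<le> K * norm x \<and> norm (x - u) < \<epsilon>"
    if "\<epsilon> > 0" for x \<epsilon>
  proof (cases "x = 0")
    case True
    then show ?thesis
      using S that by (intro exI[of _ 0]) (auto simp: subspace_0)
  next
    case False
    define c where "c = r / (2 * norm x)"
    have c: "c > 0" using False r by (simp add: c_def)
    have "norm (c *\<^sub>R x) < r" using False r by (simp add: c_def)
    moreover have "c * \<epsilon> > 0" using c that by simp
    ultimately obtain u s where u: "s \<in> S" "norm (D u - s) \<le> 2 * real k" "norm (c *\<^sub>R x - u) < c * \<epsilon>"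
      using near by blast
    have "norm (D (u /\<^sub>R c) - s /\<^sub>R c) = norm (D u - s) / c"
      using c by (simp add: scale divide_inverse flip: scaleR_diff_right)
    also have "\<dots> \<le> 2 * real k / c"
      using u c by (simp add: divide_right_mono)
    also have "\<dots> = K * norm x"
      using False r by (simp add: K_def c_def)
    finally have "norm (D (u /\<^sub>R c) - s /\<^sub>R c) \<le> K * norm x" .
    moreover have "norm (x - u /\<^sub>R c) < \<epsilon>"
    proof -
      have "x - u /\<^sub>R c = (c *\<^sub>R x - u) /\<^sub>R c"
        using c by (simp add: scaleR_diff_right)
      then have "norm (x - u /\<^sub>R c) = norm (c *\<^sub>R x - u) / c"
        using c by (simp add: divide_inverse)
      then show ?thesis using u c by (simp add: pos_divide_less_eq mult.commute)
    qed
    moreover have "s /\<^sub>R c \<in> S" using S u by (intro subspace_scale)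
    ultimately show ?thesis by blast
  qed
  then have "\<forall>x \<epsilon>. \<exists>u s. \<epsilon> > 0 \<longrightarrow> s \<in> S \<and> norm (D u - s) \<le> K * norm x \<and> norm (x - u) < \<epsilon>"
    by blast
  then obtain f g where fg: "\<And>x \<epsilon>. \<epsilon> > 0 \<Longrightarrow>
      g x \<epsilon> \<in> S \<and> norm (D (f x \<epsilon>) - g x \<epsilon>) \<le> K * norm x \<and> norm (x - f x \<epsilon>) < \<epsilon>"
    unfolding choice_iff by blast
  have "K \<ge> 0" using r by (simp add: K_def)
  have "\<exists>s\<in>S. norm (D x - s) \<le> 2 * K * norm x" for x
  proof (cases "x = 0")
    case True
    then show ?thesis using S by (auto intro!: bexI[of _ 0] simp: subspace_0)
  next
    case False
    \<comment> \<open>Successive approximation: \<open>R n\<close>, of norm at most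
      \<open>e n\<close>, is what remains of \<open>x\<close> after \<open>n\<close> corrections,
      and the errors \<open>D (u n) - s n\<close> are dominated by a geometric series with sum
      \<open>2 * K * norm x\<close>.\<close>
    define e where "e n = norm x * (1 / 2) ^ n" for n
    have e: "e n > 0" for n using False by (simp add: e_def)
    define R where "R = rec_nat x (\<lambda>n y. y - f y (e (Suc n)))"
    define u where "u n = f (R n) (e (Suc n))" for n
    define s where "s n = g (R n) (e (Suc n))" for n
    have R0: "R 0 = x" and RS: "R (Suc n) = R n - u n" for n
      by (simp_all add: R_def u_def)
    have Rle: "norm (R n) \<le> e n" for n
    proof (cases n)
      case (Suc m)
      then show ?thesis
        using fg[OF e[of "Suc m"], of "R m"] by (simp add: RS u_def)
    qed (simp add: R0 e_def)
    have sS: "s n \<in> S" for n using fg[OF e] by (simp add: s_def)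
    have us: "norm (D (u n) - s n) \<le> K * e n" for n
    proof -
      have "norm (D (u n) - s n) \<le> K * norm (R n)"
        using fg[OF e] by (simp add: u_def s_def)
      also have "\<dots> \<le> K * e n"
        using Rle \<open>K \<ge> 0\<close> by (intro mult_left_mono) auto
      finally show ?thesis .
    qed
    have sums_e: "(\<lambda>n. K * e n) sums (K * (norm x * 2))"
      unfolding e_def using geometric_sums[of "1 / 2 :: real"] by (intro sums_mult) simp_all
    then have sm: "summable (\<lambda>n. D (u n) - s n)"
      using us by (intro summable_comparison_test'[OF sums_summable[OF sums_e]]) auto
    define z where "z = (\<Sum>n. D (u n) - s n)"
    have "summable (\<lambda>n. norm (D (u n) - s n))"
      using us by (intro summable_comparison_test'[OF sums_summable[OF sums_e]]) auto
    then have "norm z \<le> (\<Sum>n. norm (D (u n) - s n))"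
      unfolding z_def by (rule summable_norm)
    also have "\<dots> \<le> (\<Sum>n. K * e n)"
      using us \<open>summable (\<lambda>n. norm (D (u n) - s n))\<close> sums_e by (intro suminf_le) (auto simp: sums_iff)
    also have "\<dots> = 2 * K * norm x"
      using sums_e by (simp add: sums_iff)
    finally have z: "norm z \<le> 2 * K * norm x" .
    have Rsum: "D (R n) = D x - (\<Sum>k<n. D (u k))" for n
      by (induction n) (simp_all add: R0 RS diff)
    have "(\<lambda>n. norm x * (1 / 2) ^ n) \<longlonglongrightarrow> norm x * 0"
      by (intro tendsto_intros LIMSEQ_realpow_zero) auto
    then have e0: "e \<longlonglongrightarrow> 0" by (simp add: e_def[abs_def])
    have "(\<lambda>n. \<Sum>k<n. D (u k) - s k) \<longlonglongrightarrow> z"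
      unfolding z_def using sm by (rule summable_LIMSEQ)
    then have "(\<lambda>n. D x - (\<Sum>k<n. D (u k) - s k)) \<longlonglongrightarrow> D x - z"
      by (intro tendsto_intros)
    then have lim: "(\<lambda>n. D (R n) + (\<Sum>k<n. s k)) \<longlonglongrightarrow> D x - z"
      by (simp add: Rsum sum_subtractf algebra_simps)
    \<comment> \<open>\<open>R n\<close> tends to 0 and the partial sums of \<open>s\<close> belong
      to \<open>S\<close>, so the limit just found does too.\<close>
    have "D x - z \<in> S"
      unfolding S_def separating_space_def
    proof (intro CollectI allI impI)
      fix \<epsilon> :: real assume "\<epsilon> > 0"
      then have "\<forall>\<^sub>F n in sequentially. e n < \<epsilon> / 2"
        by (intro order_tendstoD(2)[OF e0]) simp
      moreover have "\<forall>\<^sub>F n in sequentially. dist (D (R n) + (\<Sum>k<n. s k)) (D x - z) < \<epsilon> / 2"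
        using \<open>\<epsilon> > 0\<close> by (intro tendstoD[OF lim]) simp
      ultimately have "\<forall>\<^sub>F n in sequentially. e n < \<epsilon> / 2 \<and> dist (D (R n) + (\<Sum>k<n. s k)) (D x - z) < \<epsilon> / 2"
        by (rule eventually_conj)
      then obtain n where n: "e n < \<epsilon> / 2" "norm (D (R n) + (\<Sum>k<n. s k) - (D x - z)) < \<epsilon> / 2"
        by (auto simp: eventually_sequentially dist_norm)
      have "(\<Sum>k<n. s k) \<in> separating_space D"
        using S sS unfolding S_def by (intro subspace_sum) auto
      then obtain w where w: "norm w < \<epsilon> / 2" "norm (D w - (\<Sum>k<n. s k)) < \<epsilon> / 2"
        using \<open>\<epsilon> > 0\<close> by (meson half_gt_zero separating_spaceE)
      have "norm (R n + w) < \<epsilon>"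
        using norm_triangle_ineq[of "R n" w] Rle[of n] n w by linarith
      moreover have "norm (D (R n + w) - (D x - z)) < \<epsilon>"
        using norm_triangle_ineq[of "D (R n) + (\<Sum>k<n. s k) - (D x - z)" "D w - (\<Sum>k<n. s k)"] n w
        by (simp add: add algebra_simps)
      ultimately show "\<exists>v. norm v < \<epsilon> \<and> norm (D v - (D x - z)) < \<epsilon>" by blast
    qed
    then show ?thesis using z by (intro bexI[of _ "D x - z"]) auto
  qed
  then show thesis
    using that[of "2 * K"] \<open>K \<ge> 0\<close> unfolding S_def by simp
qed

section \<open>Derivations of commutative semisimple Banach algebras\<close>

definition peval :: "'a::comm_unital_banach_algebra \<Rightarrow> complex poly \<Rightarrow> 'a" where
  "peval y p = poly (map_poly scal p) y"

lemma peval_0 [simp]: "peval y 0 = 0"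
  by (simp add: peval_def)

lemma peval_pCons [simp]: "peval y (pCons c p) = scal c + y * peval y p"
  by (simp add: peval_def map_poly_pCons)

lemma peval_add: "peval y (p + q) = peval y p + peval y q"
  by (induction p q rule: poly_induct2) (simp_all add: scal_add algebra_simps)

lemma peval_smult: "peval y (smult c p) = scal c * peval y p"
  by (induction p) (simp_all add: scal_mult algebra_simps)

lemma peval_minus: "peval y (- p) = - peval y p"
  by (induction p) (simp_all add: scal_minus)

lemma peval_mult: "peval y (p * q) = peval y p * peval y q"
  by (induction p) (simp_all add: peval_add peval_smult algebra_simps)

lemma peval_prod: "peval y (prod f F) = (\<Prod>i\<in>F. peval y (f i))"
  by (induction F rule: infinite_finite_induct) (simp_all add: peval_mult one_pCons)

text \<open>Over the complex numbers \<open>p\<close> splits, so \<open>peval y p\<close> is a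
  product of invertible factors.\<close>

lemma peval_dvd_one:
  fixes y :: "'a::comm_unital_banach_algebra"
  assumes "p \<noteq> 0" "\<And>c. poly p c = 0 \<Longrightarrow> (y - scal c) dvd 1"
  shows "peval y p dvd 1"
proof -
  obtain r where r: "smult (lead_coeff p) (\<Prod>i<degree p. [:- r i, 1:]) = p"
    by (rule complex_poly_decompose')
  have "(y - scal (r i)) dvd 1" if "i < degree p" for i
  proof (rule assms(2))
    have "poly (\<Prod>i<degree p. [:- r i, 1:]) (r i) = 0"
      using that by (auto simp: poly_prod)
    then show "poly p (r i) = 0"
      by (metis r poly_smult mult_zero_right)
  qed
  then have "(\<Prod>i<degree p. y - scal (r i)) dvd (\<Prod>i<degree p. 1)"
    by (intro prod_dvd_prod) auto
  moreover have "scal (lead_coeff p) dvd (1::'a)"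
    using assms by (intro scal_dvd_one) auto
  ultimately have "scal (lead_coeff p) * (\<Prod>i<degree p. y - scal (r i)) dvd 1 * 1"
    by (intro mult_dvd_mono) auto
  moreover have "peval y p = scal (lead_coeff p) * (\<Prod>i<degree p. y - scal (r i))"
    by (subst r[symmetric]) (simp add: peval_smult peval_prod scal_minus)
  ultimately show ?thesis by simp
qed

section \<open>The separating space of a derivation, and Johnson's theorem\<close>

context
  fixes D :: "'a::comm_unital_banach_algebra \<Rightarrow> 'a"
  assumes D: "cderivation D"
begin

lemma derivation_add: "D (x + y) = D x + D y"
  and derivation_mult: "D (x * y) = D x * y + x * D y"
  and derivation_scaleC: "D (scaleC c x) = scaleC c (D x)"
  using D by (auto simp: cderivation_def)

lemma linear_derivation: "linear D"
  by (rule linearI) (metis derivation_add derivation_scaleC scaleC_of_real)+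

lemma derivation_scal: "D (scal c) = 0"
proof -
  have "D 1 = D 1 + D 1"
    using derivation_mult[of 1 1] by simp
  then have "D 1 = 0" by simp
  then have "D (scal c) = scal c * 0"
    unfolding scal_mult_left using derivation_scaleC[of c 1] by (simp add: scal_def)
  then show ?thesis by simp
qed

text \<open>In \<open>D (a * x) = D a * x + a * D x\<close> the first summand vanishes as
  \<open>x\<close> tends to 0.\<close>

lemma separating_space_mult:
  assumes "y \<in> separating_space D"
  shows "a * y \<in> separating_space D"
  unfolding separating_space_def
proof (intro CollectI allI impI)
  fix \<epsilon> :: real assume "\<epsilon> > 0"
  define K where "K = norm a + norm (D a) + 1"
  have K: "K > 0" by (simp add: K_def add_nonneg_pos)
  then have "\<epsilon> / K > 0" using \<open>\<epsilon> > 0\<close> by simp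
  with assms obtain x where x: "norm x < \<epsilon> / K" "norm (D x - y) < \<epsilon> / K"
    by (rule separating_spaceE)
  have "norm (a * x) \<le> norm a * norm x" by (rule norm_mult_ineq)
  also have "\<dots> \<le> K * norm x" by (intro mult_right_mono) (auto simp: K_def)
  also have "\<dots> < \<epsilon>" using x K by (simp add: pos_less_divide_eq mult.commute)
  finally have 1: "norm (a * x) < \<epsilon>" .
  have "D (a * x) - a * y = D a * x + a * (D x - y)"
    by (simp add: derivation_mult algebra_simps)
  then have "norm (D (a * x) - a * y) \<le> norm (D a) * norm x + norm a * norm (D x - y)"
    by (metis norm_triangle_le add_mono norm_mult_ineq)
  also have "\<dots> \<le> norm (D a) * (\<epsilon> / K) + norm a * (\<epsilon> / K)"
    using x by (intro add_mono mult_left_mono) auto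
  also have "\<dots> < \<epsilon>"
  proof -
    have "(norm (D a) + norm a) * (\<epsilon> / K) < K * (\<epsilon> / K)"
      using \<open>\<epsilon> / K > 0\<close> by (intro mult_strict_right_mono) (auto simp: K_def)
    then show ?thesis using K by (simp add: add_divide_distrib distrib_right)
  qed
  finally show "\<exists>z. norm z < \<epsilon> \<and> norm (D z - a * y) < \<epsilon>"
    using 1 by blast
qed

text \<open>Gliding hump: if the assertion fails for every \<open>n\<close>, there are small \<open>x n\<close> such that
  \<open>D (t n * x n)\<close> is far away from \<open>t (n + 1) S\<close>, where \<open>t n = a 0 \<cdots> a (n - 1)\<close> and \<open>S\<close> is the
  separating space. For \<open>w = (\<Sum>n. t n * x n)\<close> the terms of index greater than \<open>n\<close> have the common
  factor \<open>t (n + 1)\<close>, so modulo \<open>t (n + 1) S\<close> they contribute a bounded amount to \<open>D w\<close>; hence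
  \<open>norm (D w) \<ge> n\<close> for all \<open>n\<close>.\<close>

lemma separating_space_stability:
  "\<exists>n. \<forall>y\<in>separating_space D.
    (\<Prod>i<n. a i) * y \<in> closure ((*) (\<Prod>i<Suc n. a i) ` separating_space D)"
proof (rule ccontr)
  interpret linear D by (rule linear_derivation)
  define S where "S = separating_space D"
  have S: "subspace S" unfolding S_def by (rule subspace_separating_space) (rule linear_derivation)
  define t where "t n = (\<Prod>i<n. a i)" for n
  have tS: "t (Suc n) = t n * a n" for n by (simp add: t_def)
  assume no: "\<not> ?thesis"
  then have "\<exists>y. y \<in> S \<and> t n * y \<notin> closure ((*) (t (Suc n)) ` S)" for n
    using no unfolding S_def t_def by blast
  then obtain y where y: "\<And>n. y n \<in> S" "\<And>n. t n * y n \<notin> closure ((*) (t (Suc n)) ` S)"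
    by metis
  have hump: "\<exists>x. norm x \<le> \<epsilon> \<and> (\<forall>s\<in>S. K \<le> norm (D (t n * x) - t (Suc n) * s))"
    if "\<epsilon> > 0" "K > 0" for n K and \<epsilon> :: real
  proof -
    obtain \<eta> where \<eta>: "\<eta> > 0" "\<And>s. s \<in> S \<Longrightarrow> \<eta> \<le> norm (t n * y n - t (Suc n) * s)"
      using y(2)[of n] unfolding closure_approachable dist_norm
      by (metis image_eqI linorder_not_le norm_minus_commute)
    \<comment> \<open>Replacing \<open>y n\<close> by an approximation \<open>D x\<close> leaves the
      distance \<open>\<eta> / 2\<close>, which multiplication of \<open>x\<close> by
      \<open>c\<close> turns into \<open>K\<close>.\<close>
    define c where "c = 2 * K / \<eta>"
    have c: "c > 0" using \<eta> that by (simp add: c_def)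
    define M where "M = norm (D (t n)) + norm (t n) + 1"
    have M: "M > 0" by (simp add: M_def add_nonneg_pos)
    define \<rho> where "\<rho> = min (\<epsilon> / c) (\<eta> / (2 * M))"
    have "\<rho> > 0" using c M \<eta> that by (simp add: \<rho>_def)
    obtain x where x: "norm x < \<rho>" "norm (D x - y n) < \<rho>"
      using y(1)[of n] \<open>\<rho> > 0\<close> unfolding S_def by (rule separating_spaceE)
    have "D (t n * x) - t n * y n = D (t n) * x + t n * (D x - y n)"
      by (simp add: derivation_mult algebra_simps)
    then have "norm (D (t n * x) - t n * y n) \<le> norm (D (t n)) * norm x + norm (t n) * norm (D x - y n)"
      by (metis norm_triangle_le add_mono norm_mult_ineq)
    also have "\<dots> \<le> norm (D (t n)) * \<rho> + norm (t n) * \<rho>"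
      using x by (intro add_mono mult_left_mono) auto
    also have "\<dots> \<le> M * \<rho>"
      using \<open>\<rho> > 0\<close> by (simp add: M_def algebra_simps)
    also have "\<dots> \<le> M * (\<eta> / (2 * M))"
      using M by (intro mult_left_mono) (auto simp: \<rho>_def)
    also have "\<dots> = \<eta> / 2" using M by simp
    finally have close: "norm (D (t n * x) - t n * y n) \<le> \<eta> / 2" .
    have far: "\<eta> / 2 \<le> norm (D (t n * x) - t (Suc n) * s)" if "s \<in> S" for s
    proof -
      have "t n * y n - t (Suc n) * s = (D (t n * x) - t (Suc n) * s) - (D (t n * x) - t n * y n)"
        by simp
      then have "norm (t n * y n - t (Suc n) * s)
          \<le> norm (D (t n * x) - t (Suc n) * s) + norm (D (t n * x) - t n * y n)"
        by (metis norm_triangle_ineq4)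
      with \<eta>(2)[OF that] close show ?thesis by linarith
    qed
    have "norm (c *\<^sub>R x) = c * norm x" using c by simp
    also have "\<dots> \<le> c * (\<epsilon> / c)"
      using x c by (intro mult_left_mono) (auto simp: \<rho>_def)
    finally have "norm (c *\<^sub>R x) \<le> \<epsilon>" using c by simp
    moreover have "K \<le> norm (D (t n * c *\<^sub>R x) - t (Suc n) * s)" if "s \<in> S" for s
    proof -
      have "D (t n * c *\<^sub>R x) - t (Suc n) * s = c *\<^sub>R (D (t n * x) - t (Suc n) * (s /\<^sub>R c))"
        using c by (simp add: scale scaleR_diff_right)
      then have "norm (D (t n * c *\<^sub>R x) - t (Suc n) * s) = c * norm (D (t n * x) - t (Suc n) * (s /\<^sub>R c))"
        using c by simp
      also have "\<dots> \<ge> c * (\<eta> / 2)"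
        using c far[of "s /\<^sub>R c"] S that by (intro mult_left_mono) (auto simp: subspace_scale)
      moreover have "c * (\<eta> / 2) = K" using \<eta> by (simp add: c_def)
      ultimately show ?thesis by linarith
    qed
    ultimately show ?thesis by blast
  qed
  obtain C where C: "C \<ge> 0" "\<And>x. \<exists>s\<in>S. norm (D x - s) \<le> C * norm x"
    using separating_space_approximation[OF linear_derivation] unfolding S_def by metis
  \<comment> \<open>The summand 1 makes \<open>N (n + j)\<close> dominate the product of the norms
    over each segment \<open>{n..<n+j}\<close>.\<close>
  define N where "N n = (\<Prod>i<n. 1 + norm (a i))" for n
  have N1: "N n \<ge> 1" for n
    unfolding N_def by (intro prod_ge_1) auto
  define \<epsilon> where "\<epsilon> n = (1 / 2) ^ n / N n" for n
  have \<epsilon>: "\<epsilon> n > 0" for n using N1[of n] by (simp add: \<epsilon>_def)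
  \<comment> \<open>\<open>K n v\<close> pays for all that can cancel the hump in
    \<open>D (w 0)\<close>: the partial sum \<open>v\<close>, the term
    \<open>D (t (Suc n)) * W\<close> with \<open>norm W \<le> 2\<close>, and the distance of
    \<open>D W\<close> from \<open>S\<close>. More than \<open>n\<close> is left over.\<close>
  define K where "K n v = real n + norm (D v) + 2 * norm (D (t (Suc n))) + 2 * C * norm (t (Suc n)) + 1" for n v
  have K: "K n v > 0" for n v
    using C by (simp add: K_def add_nonneg_pos)
  obtain f where f: "\<And>n v. norm (f n v) \<le> \<epsilon> n"
      "\<And>n v s. s \<in> S \<Longrightarrow> K n v \<le> norm (D (t n * f n v) - t (Suc n) * s)"
  proof -
    have "\<forall>n v. \<exists>x. norm x \<le> \<epsilon> n \<and> (\<forall>s\<in>S. K n v \<le> norm (D (t n * x) - t (Suc n) * s))"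
      by (intro allI hump \<epsilon> K)
    then show thesis
      using that unfolding choice_iff by blast
  qed
  define v where "v = rec_nat 0 (\<lambda>n u. u + t n * f n u)"
  define x where "x n = f n (v n)" for n
  have v0: "v 0 = 0" and vS: "v (Suc n) = v n + t n * x n" for n
    by (simp_all add: v_def x_def)
  \<comment> \<open>\<open>T n j\<close> is the series term of index \<open>n + j\<close> without
    its factor \<open>t n\<close>; thus \<open>w 0 = v n + t n * w n\<close>.\<close>
  define T where "T n j = (\<Prod>i\<in>{n..<n+j}. a i) * x (n + j)" for n j
  have T: "norm (T n j) \<le> (1 / 2) ^ j" for n j
  proof -
    have prod_le: "norm (prod a F * z) \<le> (\<Prod>i\<in>F. norm (a i)) * norm z" if "finite F" for F z
      using that
    proof (induction F)
      case (insert i F)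
      have "norm (prod a (insert i F) * z) \<le> norm (a i) * norm (prod a F * z)"
        using insert.hyps norm_mult_ineq[of "a i" "prod a F * z"] by (simp add: mult.assoc)
      also have "\<dots> \<le> norm (a i) * ((\<Prod>i\<in>F. norm (a i)) * norm z)"
        by (intro mult_left_mono insert.IH) auto
      finally show ?case using insert.hyps by (simp add: mult.assoc)
    qed simp
    have "(\<Prod>i\<in>{n..<n+j}. norm (a i)) \<le> (\<Prod>i\<in>{n..<n+j}. 1 + norm (a i))"
      by (intro prod_mono) auto
    also have "\<dots> \<le> N (n + j)"
      unfolding N_def by (intro prod_mono2) auto
    finally have "(\<Prod>i\<in>{n..<n+j}. norm (a i)) * norm (x (n + j)) \<le> N (n + j) * \<epsilon> (n + j)"
      using f(1) N1[of "n + j"] by (intro mult_mono) (auto simp: x_def)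
    also have "\<dots> = (1 / 2) ^ (n + j)"
      using N1[of "n + j"] by (simp add: \<epsilon>_def)
    also have "\<dots> \<le> (1 / 2) ^ j"
      by (rule power_decreasing) auto
    finally show ?thesis
      using prod_le[of "{n..<n+j}" "x (n + j)"] by (simp add: T_def)
  qed
  have geo: "(\<lambda>j. (1 / 2) ^ j) sums (2::real)"
    using geometric_sums[of "1 / 2 :: real"] by simp
  have smT: "summable (T n)" for n
    using T by (intro summable_comparison_test'[OF sums_summable[OF geo]]) auto
  define w where "w n = suminf (T n)" for n
  have wle: "norm (w n) \<le> 2" for n
  proof -
    have sm: "summable (\<lambda>j. norm (T n j))"
      using T by (intro summable_comparison_test'[OF sums_summable[OF geo]]) auto
    then have "norm (w n) \<le> (\<Sum>j. norm (T n j))"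
      unfolding w_def by (rule summable_norm)
    also have "\<dots> \<le> (\<Sum>j. (1 / 2) ^ j)"
      using T sm geo by (intro suminf_le) (auto simp: sums_iff)
    finally show ?thesis using geo by (simp add: sums_iff)
  qed
  have wS: "w n = x n + a n * w (Suc n)" for n
  proof -
    have "T n (Suc j) = a n * T (Suc n) j" for j
      by (simp add: T_def prod.atLeast_Suc_lessThan mult.assoc del: prod.op_ivl_Suc)
    then have "(\<Sum>j. T n (Suc j)) = a n * w (Suc n)"
      unfolding w_def by (simp add: suminf_mult[OF smT])
    moreover have "w n = T n 0 + (\<Sum>j. T n (Suc j))"
      unfolding w_def using suminf_split_head[OF smT, of n] by simp
    ultimately show ?thesis by (simp add: T_def)
  qed
  have split: "w 0 = v n + t n * w n" for n
  proof (induction n)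
    case 0
    then show ?case by (simp add: v0 t_def)
  next
    case (Suc n)
    then show ?case by (simp add: vS tS wS[of n] algebra_simps)
  qed
  have "real n \<le> norm (D (w 0))" for n
  proof -
    define W where "W = w (Suc n)"
    obtain s where s: "s \<in> S" "norm (D W - s) \<le> C * norm W"
      using C by blast
    have "- s \<in> S" using S s by (simp add: subspace_neg)
    have W: "norm W \<le> 2" by (simp add: W_def wle)
    have "D (w 0) = D (v n) + D (t n * x n) + (D (t (Suc n)) * W + t (Suc n) * D W)"
      unfolding split[of "Suc n"] by (simp add: add vS W_def derivation_mult[of "t (Suc n)"])
    then have "D (t n * x n) - t (Suc n) * (- s)
        = D (w 0) - D (v n) - (D (t (Suc n)) * W + t (Suc n) * (D W - s))"
      by (simp add: algebra_simps)
    also have "norm \<dots> \<le> norm (D (w 0)) + norm (D (v n))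
        + norm (D (t (Suc n)) * W + t (Suc n) * (D W - s))"
      by (intro order_trans[OF norm_triangle_ineq4] add_mono norm_triangle_ineq4 order_refl)
    also have "norm (D (t (Suc n)) * W + t (Suc n) * (D W - s))
        \<le> norm (D (t (Suc n))) * norm W + norm (t (Suc n)) * norm (D W - s)"
      by (intro order_trans[OF norm_triangle_ineq] add_mono norm_mult_ineq)
    also have "\<dots> \<le> norm (D (t (Suc n))) * 2 + norm (t (Suc n)) * (C * 2)"
      using s W C by (intro add_mono mult_left_mono order_trans[OF s(2)]) auto
    finally have "norm (D (t n * x n) - t (Suc n) * (- s)) \<le> norm (D (w 0)) + norm (D (v n))
        + (norm (D (t (Suc n))) * 2 + norm (t (Suc n)) * (C * 2))" by simp
    moreover have "K n (v n) \<le> norm (D (t n * x n) - t (Suc n) * (- s))"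
      unfolding x_def using \<open>- s \<in> S\<close> by (rule f(2))
    ultimately show ?thesis by (simp add: K_def mult_ac)
  qed
  moreover obtain n :: nat where "norm (D (w 0)) < real n"
    using reals_Archimedean2 ..
  ultimately show False
    using leD by blast
qed

text \<open>If \<open>y - c\<^sub>n\<close> is not invertible, then \<open>y (y - c\<^sub>0) \<cdots> (y - c\<^sub>n\<^sub>-\<^sub>1)\<close> cannot be approximated by
  multiples of \<open>y - c\<^sub>n\<close>, as it is congruent to a nonzero scalar modulo \<open>y - c\<^sub>n\<close>.\<close>

lemma separating_space_finite_spectrum:
  assumes y: "y \<in> separating_space D"
  shows "finite {c. c \<noteq> 0 \<and> \<not> (y - scal c) dvd 1}"
proof (rule ccontr)
  assume "infinite {c. c \<noteq> 0 \<and> \<not> (y - scal c) dvd 1}"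
  then obtain l :: "nat \<Rightarrow> complex" where l: "inj l" "range l \<subseteq> {c. c \<noteq> 0 \<and> \<not> (y - scal c) dvd 1}"
    unfolding infinite_iff_countable_subset by (elim exE conjE)
  obtain n where n: "\<forall>z\<in>separating_space D. (\<Prod>i<n. y - scal (l i)) * z
      \<in> closure ((*) (\<Prod>i<Suc n. y - scal (l i)) ` separating_space D)"
    using separating_space_stability[of "\<lambda>i. y - scal (l i)"] by (elim exE)
  define u where "u = y - scal (l n)"
  \<comment> \<open>Modulo \<open>u\<close>, \<open>y\<close> equals \<open>l n\<close>. The last
    factor of \<open>c\<close> stems from the extra factor \<open>y\<close>, which is why the
    spectral value 0 was left out.\<close>
  define c where "c = (\<Prod>i<n. l n - l i) * l n"
  have "c \<noteq> 0"
    using l by (auto simp: c_def inj_eq)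
  have "u dvd (\<Prod>i<m. y - scal (l i)) - scal (\<Prod>i<m. l n - l i)" for m
  proof (induction m)
    case (Suc m)
    have "(\<Prod>i<Suc m. y - scal (l i)) - scal (\<Prod>i<Suc m. l n - l i)
       = ((\<Prod>i<m. y - scal (l i)) - scal (\<Prod>i<m. l n - l i)) * (y - scal (l m))
         + scal (\<Prod>i<m. l n - l i) * u"
      by (simp add: u_def scal_mult scal_diff algebra_simps)
    then show ?case using Suc by simp
  qed simp
  then have "u dvd ((\<Prod>i<n. y - scal (l i)) - scal (\<Prod>i<n. l n - l i)) * y + scal (\<Prod>i<n. l n - l i) * u"
    by simp
  moreover have "((\<Prod>i<n. y - scal (l i)) - scal (\<Prod>i<n. l n - l i)) * y + scal (\<Prod>i<n. l n - l i) * u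
      = (\<Prod>i<n. y - scal (l i)) * y - scal c"
    by (simp add: u_def c_def scal_mult algebra_simps)
  ultimately have dvd1: "u dvd (\<Prod>i<n. y - scal (l i)) * y - scal c" by simp
  obtain s where s: "norm ((\<Prod>i<Suc n. y - scal (l i)) * s - (\<Prod>i<n. y - scal (l i)) * y) < cmod c"
    using n[THEN bspec, OF y, unfolded closure_approachable, rule_format, of "cmod c"] \<open>c \<noteq> 0\<close>
    by (auto simp: dist_norm)
  define h where "h = (\<Prod>i<Suc n. y - scal (l i)) * s - (\<Prod>i<n. y - scal (l i)) * y"
  have "u dvd (\<Prod>i<Suc n. y - scal (l i)) * s"
    by (simp add: u_def)
  then have "u dvd (\<Prod>i<Suc n. y - scal (l i)) * s - ((\<Prod>i<n. y - scal (l i)) * y - scal c)"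
    using dvd1 by (rule dvd_diff)
  \<comment> \<open>As \<open>norm h < cmod c\<close>, this multiple of \<open>u\<close> is
    invertible.\<close>
  then have "u dvd scal c + h" by (simp add: h_def algebra_simps)
  also have "scal c + h = scal c * (1 - scal (- 1 / c) * h)"
  proof -
    have "scal c * scal (- 1 / c) = (- 1 :: 'a)"
      using \<open>c \<noteq> 0\<close> scal_minus[of 1] by (simp flip: scal_mult)
    then show ?thesis
      by (simp only: right_diff_distrib mult.assoc[symmetric]) simp
  qed
  also have "\<dots> dvd 1 * 1"
  proof (rule mult_dvd_mono)
    show "scal c dvd (1::'a)" using \<open>c \<noteq> 0\<close> by (rule scal_dvd_one)
    show "(1 - scal (- 1 / c) * h) dvd 1"
      using s \<open>c \<noteq> 0\<close> by (intro one_minus_dvd_one) (simp add: norm_scal_mult norm_divide h_def)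
  qed
  finally have "u dvd 1" by simp
  then show False using l by (auto simp: u_def)
qed

lemma derivation_peval: "D (peval y p) = peval y (pderiv p) * D y"
proof (induction p)
  case 0
  then show ?case using derivation_scal[of 0] by simp
next
  case (pCons c p)
  then show ?case
    by (simp add: derivation_add derivation_scal derivation_mult pderiv_pCons peval_add algebra_simps)
qed

text \<open>Taking the commutator with multiplication by \<open>a\<close> \<open>n\<close> times
  turns \<open>D ^^ n\<close> into multiplication by \<open>fact n\<close> times
  \<open>D a ^ n\<close>, while norms grow only geometrically in \<open>n\<close>.\<close>

lemma derivation_bounded_quasinilpotent:
  assumes K: "\<And>x. norm (D x) \<le> K * norm x" and "K \<ge> 0"
  shows "quasinilpotent (D a)"
proof -
  define ad :: "('a \<Rightarrow> 'a) \<Rightarrow> 'a \<Rightarrow> 'a" where "ad T = (\<lambda>x. T (a * x) - a * T x)" for T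
  have ad_apply: "ad T x = T (a * x) - a * T x" for T x
    by (simp add: ad_def)
  \<comment> \<open>Leibniz rule for \<open>ad\<close> and composition: \<open>ad D\<close> is
    multiplication by \<open>D a\<close>, which a further \<open>ad\<close> annihilates. For
    \<open>m = 0\<close> the truncated \<open>m - 1\<close> has coefficient 0.\<close>
  have ad_comp: "(ad ^^ m) (\<lambda>x. D (T x))
      = (\<lambda>x. D ((ad ^^ m) T x) + real m *\<^sub>R (D a * (ad ^^ (m - 1)) T x))" for m T
  proof (induction m)
    case (Suc m)
    define U V where "U = (ad ^^ m) T" and "V = (ad ^^ (m - 1)) T"
    have V: "real m *\<^sub>R (D a * ad V x) = real m *\<^sub>R (D a * U x)" for x
      by (cases m) (simp_all add: U_def V_def)
    have "(ad ^^ Suc m) (\<lambda>x. D (T x)) x = ad (\<lambda>x. D (U x) + real m *\<^sub>R (D a * V x)) x" for x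
      by (simp add: Suc U_def V_def)
    also have "\<dots> x = D (ad U x + a * U x) - a * D (U x) + real m *\<^sub>R (D a * ad V x)" for x
      by (simp add: ad_apply algebra_simps)
    also have "\<dots> x = D (ad U x) + real (Suc m) *\<^sub>R (D a * U x)" for x
      unfolding V by (simp add: derivation_add derivation_mult algebra_simps)
    finally show ?case
      by (simp add: U_def fun_eq_iff)
  qed simp
  have key: "(ad ^^ n) (D ^^ n) = (\<lambda>x. fact n *\<^sub>R (D a ^ n * x))" for n
  proof (induction n)
    case (Suc n)
    have "(ad ^^ Suc n) (D ^^ n) = (\<lambda>x. 0)"
      by (simp add: Suc) (simp add: ad_apply fun_eq_iff algebra_simps)
    moreover have "D 0 = 0" using derivation_scal[of 0] by simp
    moreover have "D ^^ Suc n = (\<lambda>x. D ((D ^^ n) x))" by (simp add: fun_eq_iff)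
    ultimately have "(ad ^^ Suc n) (D ^^ Suc n) = (\<lambda>x. real (Suc n) *\<^sub>R (D a * (ad ^^ n) (D ^^ n) x))"
      by (simp only: ad_comp) simp
    then show ?case by (simp only: Suc) (simp add: fun_eq_iff mult.assoc)
  qed (simp add: fun_eq_iff)
  have Dn: "norm ((D ^^ n) x) \<le> K ^ n * norm x" for n x
  proof (induction n)
    case (Suc n)
    have "norm ((D ^^ Suc n) x) \<le> K * norm ((D ^^ n) x)" by (simp add: K)
    also have "\<dots> \<le> K * (K ^ n * norm x)" using Suc \<open>K \<ge> 0\<close> by (intro mult_left_mono)
    finally show ?case by (simp add: mult.assoc)
  qed simp
  have adm: "norm ((ad ^^ m) T x) \<le> (2 * norm a) ^ m * (M * norm x)"
    if "\<And>x. norm (T x) \<le> M * norm x" "M \<ge> 0" for m T M x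
  proof (induction m arbitrary: x)
    case (Suc m)
    have "norm ((ad ^^ Suc m) T x) \<le> norm ((ad ^^ m) T (a * x)) + norm (a * (ad ^^ m) T x)"
      by (simp add: ad_apply norm_triangle_ineq4)
    also have "\<dots> \<le> (2 * norm a) ^ m * (M * norm (a * x)) + norm a * norm ((ad ^^ m) T x)"
      by (intro add_mono Suc norm_mult_ineq)
    also have "\<dots> \<le> (2 * norm a) ^ m * (M * (norm a * norm x)) + norm a * ((2 * norm a) ^ m * (M * norm x))"
      using that(2) by (intro add_mono mult_left_mono norm_mult_ineq Suc) auto
    finally show ?case by (simp add: algebra_simps)
  qed (use that in simp)
  have le: "fact n * norm (D a ^ n) \<le> norm (1::'a) * (2 * norm a * K) ^ n" for n
    using adm[of "D ^^ n" "K ^ n" n 1, OF Dn] \<open>K \<ge> 0\<close>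
    by (simp add: key power_mult_distrib mult_ac)
  show ?thesis
    unfolding quasinilpotent_def
  proof (intro allI impI)
    fix r :: real assume "r \<ge> 0"
    have bound: "norm (r ^ n * norm (D a ^ n)) \<le> norm (1::'a) * (inverse (fact n) * (r * (2 * norm a * K)) ^ n)" for n
    proof -
      have "norm (D a ^ n) \<le> norm (1::'a) * (2 * norm a * K) ^ n / fact n"
        using le[of n] by (simp add: pos_le_divide_eq mult.commute)
      then have "r ^ n * norm (D a ^ n) \<le> r ^ n * (norm (1::'a) * (2 * norm a * K) ^ n / fact n)"
        using \<open>r \<ge> 0\<close> by (intro mult_left_mono) auto
      also have "\<dots> = norm (1::'a) * (inverse (fact n) * (r * (2 * norm a * K)) ^ n)"
        by (simp add: power_mult_distrib[of r] divide_inverse)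
      finally show ?thesis using \<open>r \<ge> 0\<close> by (simp add: abs_mult)
    qed
    have "(\<lambda>n. norm (1::'a) * (inverse (fact n) * (r * (2 * norm a * K)) ^ n)) \<longlonglongrightarrow> norm (1::'a) * 0"
      by (intro tendsto_intros summable_LIMSEQ_zero summable_exp)
    then have lim: "(\<lambda>n. norm (1::'a) * (inverse (fact n) * (r * (2 * norm a * K)) ^ n)) \<longlonglongrightarrow> 0"
      by (simp only: mult_zero_right)
    show "(\<lambda>n. r ^ n * norm (D a ^ n)) \<longlonglongrightarrow> 0"
      by (rule Lim_null_comparison[OF always_eventually lim]) (rule allI, rule bound)
  qed
qed

theorem derivation_semisimple_eq_0:
  assumes semisimple: "\<And>x::'a. (\<And>b. (1 - b * x) dvd 1) \<Longrightarrow> x = 0"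
  shows "D x = 0"
proof -
  interpret linear D by (rule linear_derivation)
  have qn0: "q = 0" if "quasinilpotent q" for q :: 'a
    using that by (intro semisimple quasinilpotent_one_minus_mult_dvd_one)
  have D0: "D y = 0" if y: "y \<in> separating_space D" for y
  proof -
    \<comment> \<open>Including 0 gives \<open>p\<close> the root 0, so that
      \<open>1 - smult c p\<close> and \<open>pderiv p\<close> are not the zero polynomial.\<close>
    define F where "F = insert 0 {c. c \<noteq> 0 \<and> \<not> (y - scal c) dvd 1}"
    have F: "finite F"
      using separating_space_finite_spectrum[OF y] by (simp add: F_def)
    have inv: "(y - scal c) dvd 1" if "c \<notin> F" for c
      using that by (auto simp: F_def)
    define p :: "complex poly" where "p = (\<Prod>c\<in>F. [:- c, 1:])"
    have root: "poly p c = 0 \<longleftrightarrow> c \<in> F" for c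
      using F by (auto simp: p_def poly_prod)
    have "(1 - scal c * peval y p) dvd 1" for c
    proof (cases "c = 0")
      case False
      \<comment> \<open>The roots of \<open>1 - smult c p\<close> are outside \<open>F\<close>,
        where \<open>y - scal z\<close> is invertible.\<close>
      have "peval y (1 - smult c p) dvd 1"
      proof (rule peval_dvd_one)
        show "1 - smult c p \<noteq> 0"
        proof
          assume "1 - smult c p = 0"
          then have "poly (1 - smult c p) 0 = 0" by simp
          moreover have "poly p 0 = 0" using root by (simp add: F_def)
          ultimately show False by simp
        qed
        fix z assume "poly (1 - smult c p) z = 0"
        then have "poly p z \<noteq> 0" by auto
        then show "(y - scal z) dvd 1" using root inv by blast
      qed
      moreover have "peval y (1 - smult c p) = 1 - scal c * peval y p"
        using peval_add[of y 1 "- smult c p"]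
        by (simp add: peval_smult peval_minus one_pCons)
      ultimately show ?thesis by simp
    qed simp
    then have "peval y p = 0"
      by (intro qn0 quasinilpotent_if_no_nonzero_spectrum)
    then have "peval y (pderiv p) * D y = 0"
      by (simp add: zero flip: derivation_peval)
    moreover have "peval y (pderiv p) dvd 1"
    proof (rule peval_dvd_one)
      have simple: "poly (pderiv p) c \<noteq> 0" if "c \<in> F" for c
      proof -
        have "p = [:- c, 1:] * (\<Prod>c\<in>F - {c}. [:- c, 1:])"
          unfolding p_def using F that by (simp add: prod.remove del: mult_pCons_left)
        then have "poly (pderiv p) c = poly (\<Prod>c\<in>F - {c}. [:- c, 1:]) c"
          by (simp add: pderiv_mult pderiv_pCons del: mult_pCons_left)
        then show ?thesis using F by (auto simp: poly_prod)
      qed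
      show "pderiv p \<noteq> 0"
        using simple[of 0] by (auto simp: F_def)
      show "(y - scal c) dvd 1" if "poly (pderiv p) c = 0" for c
        using that simple inv by blast
    qed
    then obtain v where "peval y (pderiv p) * v = 1" by (metis dvd_def)
    ultimately show ?thesis
      by (metis mult.commute mult.left_commute mult_1 mult_zero_right)
  qed
  have S0: "y = 0" if y: "y \<in> separating_space D" for y
  proof -
    \<comment> \<open>\<open>x * y\<close> is in the separating space as well, so \<open>D\<close>
      vanishes at both \<open>y\<close> and \<open>x * y\<close>.\<close>
    have yD: "y * D x = 0" for x
      using D0[OF separating_space_mult[OF y, of x]] D0[OF y] derivation_mult[of x y]
        D0[OF y] derivation_mult[of y x] by (simp add: mult.commute)
    \<comment> \<open>\<open>y\<close> is a limit of values of \<open>D\<close>, all of which it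
      annihilates.\<close>
    have "y * y = 0"
    proof (rule ccontr)
      assume "y * y \<noteq> 0"
      then have "norm (y * y) > 0" "norm y > 0" by auto
      then have "norm (y * y) / norm y > 0" by simp
      with y obtain x where "norm (D x - y) < norm (y * y) / norm y"
        by (rule separating_spaceE)
      then have "norm y * norm (D x - y) < norm (y * y)"
        using \<open>norm y > 0\<close> by (simp add: pos_less_divide_eq mult.commute)
      moreover have "norm (y * (D x - y)) \<le> norm y * norm (D x - y)"
        by (rule norm_mult_ineq)
      ultimately show False by (simp add: right_diff_distrib yD)
    qed
    then have "(1 - b * y) * (1 + b * y) = 1" for b
      by (simp add: algebra_simps)
    then show ?thesis
      by (intro semisimple) (metis dvd_triv_left)
  qed
  obtain C where C: "C \<ge> 0" "\<And>x. \<exists>s\<in>separating_space D. norm (D x - s) \<le> C * norm x"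
    using separating_space_approximation[OF linear_derivation] by metis
  then have "norm (D x) \<le> C * norm x" for x
    using S0 by (metis diff_zero)
  then show ?thesis
    using C(1) by (intro qn0 derivation_bounded_quasinilpotent)
qed

end

section \<open>The commutative core of a Banach algebra with a right identity\<close>

text \<open>Suppose that \<open>e\<close> is a right identity and that \<open>x a b = x b a\<close> holds for all \<open>x, a, b\<close>. Then
  \<open>e A\<close> is a commutative closed subalgebra with identity \<open>e\<close>. It has to be a type in order to
  apply the results above. A type cannot depend on the two assumptions, so if one of them fails,
  \<open>core_unit\<close> is \<open>0\<close> and \<open>e A\<close> is trivial; the additional direct summand \<open>complex\<close> guarantees
  \<open>0 \<noteq> 1\<close>.\<close>

definition core_unit :: "'a::complex_banach_algebra" where
  "core_unit = (if (\<exists>e::'a. \<forall>a. a * e = a) \<and> (\<forall>x a b::'a. x * a * b = x * b * a)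
     then SOME e. \<forall>a. a * e = a else 0)"

lemma core_unit_right:
  assumes "\<exists>e::'a::complex_banach_algebra. \<forall>a. a * e = a" "\<forall>x a b::'a. x * a * b = x * b * a"
  shows "a * (core_unit :: 'a) = a"
  using assms someI_ex[OF assms(1)] by (simp add: core_unit_def)

lemma core_unit_trivial:
  assumes "\<not> ((\<exists>e::'a::complex_banach_algebra. \<forall>a. a * e = a) \<and> (\<forall>x a b::'a. x * a * b = x * b * a))"
  shows "(core_unit :: 'a) = 0"
  unfolding core_unit_def using assms by (rule if_not_P)

lemma core_unit_idem: "core_unit * core_unit = (core_unit :: 'a::complex_banach_algebra)"
  using core_unit_right core_unit_trivial by (metis mult_zero_left)

lemma core_mult_commute:
  fixes x y :: "'a::complex_banach_algebra"
  assumes "core_unit * x = x" "core_unit * y = y"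
  shows "x * y = y * x"
proof (cases "(\<exists>e::'a. \<forall>a. a * e = a) \<and> (\<forall>x a b::'a. x * a * b = x * b * a)")
  case True
  then have "core_unit * x * y = core_unit * y * x" by blast
  then show ?thesis by (simp add: assms)
next
  case False
  then show ?thesis using core_unit_trivial[OF False] assms by simp
qed

section \<open>The direct sum of \<open>e A\<close> and the complex numbers as a Banach
  algebra\<close>

typedef (overloaded) 'a core = "{p :: 'a::complex_banach_algebra \<times> complex. core_unit * fst p = fst p}"
  by (rule exI[of _ 0]) simp

setup_lifting type_definition_core

instantiation core :: (complex_banach_algebra) real_vector
begin

lift_definition zero_core :: "'a core" is 0 by simp
lift_definition plus_core :: "'a core \<Rightarrow> 'a core \<Rightarrow> 'a core" is "(+)" by (simp add: distrib_left)
lift_definition minus_core :: "'a core \<Rightarrow> 'a core \<Rightarrow> 'a core" is "(-)" by (simp add: right_diff_distrib)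
lift_definition uminus_core :: "'a core \<Rightarrow> 'a core" is uminus by simp
lift_definition scaleR_core :: "real \<Rightarrow> 'a core \<Rightarrow> 'a core" is "(*\<^sub>R)" by simp

instance
  by standard (transfer; simp add: algebra_simps)+

end

instantiation core :: (complex_banach_algebra) real_normed_vector
begin

lift_definition norm_core :: "'a core \<Rightarrow> real" is norm .

definition dist_core :: "'a core \<Rightarrow> 'a core \<Rightarrow> real" where
  "dist_core x y = norm (x - y)"

definition sgn_core :: "'a core \<Rightarrow> 'a core" where
  "sgn_core x = x /\<^sub>R norm x"

definition uniformity_core :: "('a core \<times> 'a core) filter" where
  "uniformity_core = (INF e\<in>{0 <..}. principal {(x, y). dist x y < e})"

definition open_core :: "'a core set \<Rightarrow> bool" where
  "open_core U \<longleftrightarrow> (\<forall>x\<in>U. eventually (\<lambda>(x', y). x' = x \<longrightarrow> y \<in> U) uniformity)"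

instance
proof
  fix x y :: "'a core" and a :: real
  show "dist x y = norm (x - y)" by (rule dist_core_def)
  show "sgn x = x /\<^sub>R norm x" by (rule sgn_core_def)
  show "uniformity = (INF e\<in>{0 <..}. principal {(x::'a core, y). dist x y < e})"
    by (rule uniformity_core_def)
  show "open U \<longleftrightarrow> (\<forall>x\<in>U. eventually (\<lambda>(x', y). x' = x \<longrightarrow> y \<in> U) uniformity)" for U :: "'a core set"
    by (rule open_core_def)
  show "norm x = 0 \<longleftrightarrow> x = 0" by transfer simp
  show "norm (x + y) \<le> norm x + norm y" by transfer (rule norm_triangle_ineq)
  show "norm (a *\<^sub>R x) = \<bar>a\<bar> * norm x" by transfer simp
qed

end

instance core :: (complex_banach_algebra) banach
proof
  fix X :: "nat \<Rightarrow> 'a core"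
  assume X: "Cauchy X"
  have rep: "dist x y = dist (Rep_core x) (Rep_core y)" for x y :: "'a core"
    by (simp add: dist_norm norm_core.rep_eq minus_core.rep_eq)
  have "Cauchy (\<lambda>n. Rep_core (X n))"
    using X unfolding Cauchy_def by (simp add: rep)
  then obtain p where p: "(\<lambda>n. Rep_core (X n)) \<longlonglongrightarrow> p"
    by (auto simp: Cauchy_convergent_iff convergent_def)
  have "(\<lambda>n. core_unit * fst (Rep_core (X n))) \<longlonglongrightarrow> core_unit * fst p"
    by (intro tendsto_intros p)
  moreover have "(\<lambda>n. fst (Rep_core (X n))) \<longlonglongrightarrow> fst p"
    by (intro tendsto_intros p)
  moreover have "core_unit * fst (Rep_core (X n)) = fst (Rep_core (X n))" for n
    using Rep_core[of "X n"] by simp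
  ultimately have "core_unit * fst p = fst p"
    by (simp add: LIMSEQ_unique)
  then have "Rep_core (Abs_core p) = p"
    by (simp add: Abs_core_inverse)
  with p have "X \<longlonglongrightarrow> Abs_core p"
    unfolding lim_sequentially by (simp add: rep)
  then show "convergent X"
    by (rule convergentI)
qed

instantiation core :: (complex_banach_algebra) comm_unital_banach_algebra
begin

lift_definition one_core :: "'a core" is "(core_unit, 1)" by (simp add: core_unit_idem)
lift_definition times_core :: "'a core \<Rightarrow> 'a core \<Rightarrow> 'a core" is
  "\<lambda>p q. (fst p * fst q, snd p * snd q)" by (simp flip: mult.assoc)
lift_definition scaleC_core :: "complex \<Rightarrow> 'a core \<Rightarrow> 'a core" is
  "\<lambda>c p. (scaleC c (fst p), c * snd p)" by (simp add: scaleC_mult_right)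

instance
proof
  fix x y z :: "'a core" and a :: real and c c' :: complex
  show "x * y * z = x * (y * z)" by transfer (simp add: mult.assoc)
  show "(x + y) * z = x * z + y * z" by transfer (simp add: distrib_right)
  show "x * (y + z) = x * y + x * z" by transfer (simp add: distrib_left)
  show "x * y = y * x" by transfer (simp add: core_mult_commute mult.commute)
  show "1 * x = x" by transfer simp
  show "(0::'a core) \<noteq> 1" by transfer (simp add: zero_prod_def)
  show "(a *\<^sub>R x) * y = a *\<^sub>R (x * y)" by transfer simp
  show "x * (a *\<^sub>R y) = a *\<^sub>R (x * y)" by transfer simp
  show "norm (x * y) \<le> norm x * norm y"
  proof transfer
    fix p q :: "'a \<times> complex"
    have "norm (fst p * fst q, snd p * snd q) \<le> sqrt ((norm (fst p) * norm (fst q))\<^sup>2 + (norm (snd p) * norm (snd q))\<^sup>2)"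
      unfolding norm_Pair
      by (intro real_sqrt_le_mono add_mono power_mono norm_mult_ineq) auto
    also have "\<dots> \<le> sqrt (((norm (fst p))\<^sup>2 + (norm (snd p))\<^sup>2) * ((norm (fst q))\<^sup>2 + (norm (snd q))\<^sup>2))"
      by (intro real_sqrt_le_mono) (simp add: power_mult_distrib algebra_simps)
    also have "\<dots> = norm p * norm q"
      by (simp add: real_sqrt_mult norm_prod_def)
    finally show "norm (fst p * fst q, snd p * snd q) \<le> norm p * norm q" .
  qed
  show "scaleC (complex_of_real a) x = a *\<^sub>R x"
    by transfer (simp add: scaleC_of_real prod_eq_iff scaleR_conv_of_real)
  show "scaleC (c + c') x = scaleC c x + scaleC c' x"
    by transfer (simp add: scaleC_add_left prod_eq_iff distrib_right)
  show "scaleC c (x + y) = scaleC c x + scaleC c y"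
    by transfer (simp add: scaleC_add_right prod_eq_iff distrib_left)
  show "scaleC c (scaleC c' x) = scaleC (c * c') x"
    by transfer (simp add: scaleC_scaleC mult.assoc)
  show "norm (scaleC c x) = cmod c * norm x"
  proof transfer
    fix c and p :: "'a \<times> complex"
    have "norm (scaleC c (fst p), c * snd p) = sqrt ((cmod c)\<^sup>2 * ((norm (fst p))\<^sup>2 + (norm (snd p))\<^sup>2))"
      by (simp add: norm_Pair norm_scaleC norm_mult power_mult_distrib distrib_left)
    then show "norm (scaleC c (fst p), c * snd p) = cmod c * norm p"
      by (simp add: real_sqrt_mult norm_prod_def)
  qed
  show "scaleC c x * y = scaleC c (x * y)"
    by transfer (simp add: scaleC_mult_left mult.assoc)
  show "x * scaleC c y = scaleC c (x * y)"
    by transfer (simp add: scaleC_mult_right mult.left_commute)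
qed

end

text \<open>A derivation of \<open>e A\<close> extends by \<open>0\<close> to the direct sum with \<open>complex\<close>. The radical of that
  sum vanishes because an element of \<open>e A\<close> which is in the radical of \<open>e A\<close> is also in the radical of
  \<open>A\<close>: if \<open>(e - e b x) v = e\<close> with \<open>v\<close> in \<open>e A\<close> and \<open>r = b x - e b x\<close>, the quasi-inverse of \<open>b x\<close>
  is \<open>e - v - r v\<close>.\<close>

lemma derivation_core_eq_0:
  fixes \<delta> :: "'a::complex_banach_algebra \<Rightarrow> 'a"
  assumes right_id: "\<exists>e::'a. \<forall>a. a * e = a"
    and right_comm: "\<forall>x a b::'a. x * a * b = x * b * a"
    and rad: "(jacobson_rad :: 'a set) = rann"
    and \<delta>: "cderivation \<delta>" and \<delta>_unit: "\<delta> core_unit = 0"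
    and x: "core_unit * x = x"
  shows "\<delta> x = 0"
proof -
  let ?e = "core_unit :: 'a"
  have e: "a * ?e = a" for a :: 'a
    by (rule core_unit_right[OF right_id right_comm])
  have \<delta>_add: "\<delta> (a + b) = \<delta> a + \<delta> b" and \<delta>_scaleC: "\<delta> (scaleC c a) = scaleC c (\<delta> a)"
    and \<delta>_mult: "\<delta> (a * b) = \<delta> a * b + a * \<delta> b" for a b c
    using \<delta> by (auto simp: cderivation_def)
  have \<delta>_core: "?e * \<delta> a = \<delta> a" if "?e * a = a" for a
    using \<delta>_mult[of ?e a] that by (simp add: \<delta>_unit)
  define D where "D c = Abs_core (\<delta> (fst (Rep_core c)), 0)" for c
  have Rep: "?e * fst (Rep_core c) = fst (Rep_core c)" for c :: "'a core"
    using Rep_core[of c] by simp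
  have RepD: "Rep_core (D c) = (\<delta> (fst (Rep_core c)), 0)" for c
    unfolding D_def by (rule Abs_core_inverse) (simp add: \<delta>_core Rep)
  have "cderivation D"
    unfolding cderivation_def
    by (simp add: Rep_core_inject[symmetric] RepD plus_core.rep_eq times_core.rep_eq
        scaleC_core.rep_eq \<delta>_add \<delta>_scaleC \<delta>_mult)
  moreover have "y = 0" if inv: "\<And>b. (1 - b * y) dvd 1" for y :: "'a core"
  proof -
    define x z where "x = fst (Rep_core y)" and "z = snd (Rep_core y)"
    have x: "?e * x = x" by (simp add: x_def Rep)
    have "z = 0"
    proof (rule ccontr)
      assume "z \<noteq> 0"
      \<comment> \<open>This \<open>b\<close> makes the complex component of
        \<open>1 - b * y\<close> zero.\<close>
      define b :: "'a core" where "b = Abs_core (0, 1 / z)"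
      have "Rep_core b = (0, 1 / z)" unfolding b_def by (rule Abs_core_inverse) simp
      then have snd0: "snd (Rep_core (1 - b * y)) = 0"
        using \<open>z \<noteq> 0\<close> by (simp add: minus_core.rep_eq one_core.rep_eq times_core.rep_eq z_def)
      obtain v where "1 = (1 - b * y) * v" using inv[of b] by (rule dvdE)
      then have "snd (Rep_core (1 :: 'a core)) = snd (Rep_core ((1 - b * y) * v))" by simp
      then show False by (simp add: times_core.rep_eq snd0 one_core.rep_eq)
    qed
    have "quasi_invertible (b * x)" for b
    proof -
      define r where "r = b * x - ?e * b * x"
      have r: "a * r = 0" for a
        by (simp add: r_def right_diff_distrib e flip: mult.assoc)
      define B :: "'a core" where "B = Abs_core (?e * b, 0)"
      have B: "Rep_core B = (?e * b, 0)"
        unfolding B_def by (rule Abs_core_inverse) (simp add: core_unit_idem flip: mult.assoc)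
      obtain V where "1 = (1 - B * y) * V" using inv[of B] by (rule dvdE)
      then have "fst (Rep_core (1 :: 'a core)) = fst (Rep_core ((1 - B * y) * V))" by simp
      moreover define v where "v = fst (Rep_core V)"
      ultimately have v1: "(?e - ?e * b * x) * v = ?e"
        by (simp add: times_core.rep_eq minus_core.rep_eq one_core.rep_eq B x_def)
      have v: "?e * v = v" by (simp add: v_def Rep)
      have ebx: "?e * (?e * b * x) = ?e * b * x"
        by (simp add: core_unit_idem flip: mult.assoc)
      then have v2: "v * (?e - ?e * b * x) = ?e"
        using v1 core_mult_commute[of v "?e - ?e * b * x"] v
        by (simp add: right_diff_distrib core_unit_idem)
      define w where "w = ?e - v - r * v"
      have bx: "b * x = ?e * b * x + r" by (simp add: r_def)
      have v1': "?e * b * x * v = v - ?e" and v2': "v * (?e * b * x) = v - ?e"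
        using v1 v2 by (simp_all add: left_diff_distrib right_diff_distrib v e algebra_simps)
      have rr: "a * (r * c) = 0" for a c
        by (simp add: r flip: mult.assoc)
      have "b * x + w - b * x * w = 0"
      proof -
        have "b * x * w = ?e * b * x - (v - ?e) + r - r * v"
          unfolding bx w_def distrib_right right_diff_distrib rr e v1' by simp
        then show ?thesis by (simp add: bx w_def)
      qed
      moreover have "w + b * x - w * (b * x) = 0"
      proof -
        have "r * v * (?e * b * x) = r * v - r"
          unfolding mult.assoc[of r v] v2' by (simp add: right_diff_distrib e)
        then have "w * (b * x) = ?e * b * x - (v - ?e) - (r * v - r)"
          unfolding bx w_def distrib_left left_diff_distrib r ebx v2' by simp
        then show ?thesis by (simp add: bx w_def)
      qed
      ultimately show ?thesis
        unfolding quasi_invertible_def by blast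
    qed
    then have "x \<in> rann"
      unfolding rad[symmetric] jacobson_rad_def by simp
    then have "x = 0"
      using x by (simp add: rann_def)
    then show "y = 0"
      using \<open>z = 0\<close> by (simp add: Rep_core_inject[symmetric] zero_core.rep_eq prod_eq_iff x_def z_def)
  qed
  ultimately have "D (Abs_core (x, 0)) = 0"
    by (rule derivation_semisimple_eq_0)
  moreover have "Rep_core (Abs_core (x, 0)) = (x, 0)"
    by (rule Abs_core_inverse) (simp add: x)
  ultimately show ?thesis
    using RepD[of "Abs_core (x, 0)"] by (simp add: zero_core.rep_eq zero_prod_def)
qed

section \<open>Derivations of Banach algebras with a right identity\<close>

text \<open>The leading factor \<open>a\<close> allows \<open>pow1 a n\<close> and \<open>b\<close>
  to be swapped behind it.\<close>

lemma commutator_mult_pow1: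
  fixes a b :: "'a::ring"
  assumes "\<forall>x a b::'a. x * a * b = x * b * a"
  shows "commutator (a * b) (pow1 a n) = 0"
proof -
  have "pow1 a n * a = a * pow1 a n"
    by (induction n) (simp_all add: mult.assoc)
  then have "pow1 a n * (a * b) = a * pow1 a n * b"
    by (metis mult.assoc)
  also have "\<dots> = a * b * pow1 a n"
    using assms by blast
  finally show ?thesis by (simp add: commutator_def)
qed

lemma inner_derivation_if_k_centralizing:
  fixes d :: "'a::complex_banach_algebra \<Rightarrow> 'a"
  assumes rad: "(jacobson_rad :: 'a set) = rann"
    and comm: "\<forall>a b::'a. a * b - b * a \<in> jacobson_rad"
    and right_id: "\<exists>e::'a. \<forall>a. a * e = a"
    and d: "cderivation d"
    and k: "k_centralizing k (\<lambda>a. d a + b * a)"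
  shows "inner_derivation d"
proof -
  let ?e = "core_unit :: 'a"
  have R: "x * (a * b - b * a) = 0" for x a b :: 'a
    using comm unfolding rad rann_def by blast
  have right_comm: "\<forall>x a b::'a. x * a * b = x * b * a"
  proof (intro allI)
    fix x a b :: 'a
    show "x * a * b = x * b * a"
      using R[of x a b] by (simp add: right_diff_distrib mult.assoc)
  qed
  have e: "a * ?e = a" for a :: 'a
    by (rule core_unit_right[OF right_id right_comm])
  define \<delta> where "\<delta> a = d a - (a * b - b * a)" for a
  have \<delta>: "cderivation \<delta>"
  proof -
    have sub: "scaleC c (x - y) = scaleC c x - scaleC c y" for c and x y :: 'a
      by (metis add_diff_cancel_right' diff_add_cancel scaleC_add_right)
    have "d (x + y) = d x + d y" "d (scaleC c x) = scaleC c (d x)" "d (x * y) = d x * y + x * d y" for x y c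
      using d by (auto simp: cderivation_def)
    then show ?thesis
      unfolding cderivation_def \<delta>_def
      by (simp add: sub scaleC_mult_left scaleC_mult_right) (simp add: algebra_simps)
  qed
  then have \<delta>_add: "\<delta> (x + y) = \<delta> x + \<delta> y" and \<delta>_mult: "\<delta> (x * y) = \<delta> x * y + x * \<delta> y" for x y
    by (auto simp: cderivation_def)
  have \<delta>_comm: "\<delta> a * pow1 a (k - 1) = pow1 a (k - 1) * \<delta> a" for a
  proof -
    define c where "c = commutator (\<delta> a) (pow1 a (k - 1))"
    have "commutator (d a + b * a) (pow1 a (k - 1))
        = c + commutator (a * b) (pow1 a (k - 1))"
      by (simp add: c_def commutator_def \<delta>_def algebra_simps)
    then have "commutator (d a + b * a) (pow1 a (k - 1)) = c"
      by (simp only: commutator_mult_pow1[OF right_comm] add_0_right)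
    moreover have "commutator (d a + b * a) (pow1 a (k - 1)) \<in> center"
      using k unfolding k_centralizing_def by (rule spec)
    ultimately have "c \<in> center" by (simp only:)
    \<comment> \<open>The right identity fixes \<open>c\<close> from the right but kills it, as a
      commutator, from the left.\<close>
    then have "c * ?e = ?e * c" by (simp add: center_def)
    also have "?e * c = 0"
      unfolding c_def commutator_def by (rule R)
    finally have "c = 0" by (simp add: e)
    then show ?thesis by (simp add: c_def commutator_def)
  qed
  have pow1_idem: "pow1 a n = a" if "a * a = a" for a :: 'a and n
    using that by (induction n) simp_all
  \<comment> \<open>Commuting with the idempotent \<open>e\<close> gives
    \<open>e * \<delta> e = \<delta> e\<close>, and the product rule then gives
    \<open>\<delta> e = \<delta> e + \<delta> e\<close>.\<close>
  have \<delta>_unit: "\<delta> ?e = 0"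
    using \<delta>_comm[of ?e] \<delta>_mult[of ?e ?e] by (simp add: pow1_idem e)
  have \<delta>_rann: "\<delta> c = 0" if "c \<in> rann" for c
  proof -
    have c: "x * c = 0" for x using that by (simp add: rann_def)
    have "x * \<delta> c = 0" for x
    proof -
      have "\<delta> 0 = 0" using \<delta>_add[of 0 0] by simp
      then show ?thesis using \<delta>_mult[of x c] by (simp add: c)
    qed
    moreover have "\<delta> (?e + c) = \<delta> c" by (simp add: \<delta>_add \<delta>_unit)
    \<comment> \<open>The idempotent \<open>e + c\<close> commutes with \<open>\<delta> c\<close>;
      multiplying by it gives \<open>\<delta> c\<close> on the right and 0 on the left.\<close>
    moreover have "(?e + c) * (?e + c) = ?e + c"
      by (simp add: distrib_left c e)
    ultimately show ?thesis
      using \<delta>_comm[of "?e + c"] by (simp add: pow1_idem distrib_left c e)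
  qed
  have "\<delta> a = 0" for a
  proof -
    have "?e * (?e * a) = ?e * a" by (simp add: core_unit_idem flip: mult.assoc)
    then have "\<delta> (?e * a) = 0"
      by (rule derivation_core_eq_0[OF right_id right_comm rad \<delta> \<delta>_unit])
    moreover have "a - ?e * a \<in> rann"
      by (simp add: rann_def right_diff_distrib e flip: mult.assoc)
    ultimately show ?thesis
      using \<delta>_rann \<delta>_add[of "?e * a" "a - ?e * a"] by simp
  qed
  then have "\<forall>a. d a = a * b - b * a" by (simp add: \<delta>_def)
  then show ?thesis unfolding inner_derivation_def by blast
qed

lemma k_commuting_if_inner_derivation:
  fixes d :: "'a::ring \<Rightarrow> 'a"
  assumes "\<forall>x a b::'a. x * a * b = x * b * a" "inner_derivation d"
  shows "\<exists>b. \<forall>k. k_commuting k (\<lambda>a. d a + b * a)"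
proof -
  obtain b where b: "\<forall>a. d a = a * b - b * a"
    using assms by (auto simp: inner_derivation_def)
  then have "k_commuting k (\<lambda>a. d a + b * a)" for k
    using commutator_mult_pow1[OF assms(1)] by (simp add: k_commuting_def)
  then show ?thesis by blast
qed

theorem theorem4p5:
  fixes d :: "'a::complex_banach_algebra \<Rightarrow> 'a"
  assumes "(jacobson_rad :: 'a set) = rann"
    and "\<forall>a b::'a. a * b - b * a \<in> jacobson_rad"
    and "\<exists>e::'a. \<forall>a. a * e = a"
    and "cderivation d"
  shows "(inner_derivation d \<longleftrightarrow>
           (\<exists>b0. \<forall>k\<ge>1. k_commuting k (\<lambda>a. d a + b0 * a)))
       \<and> (inner_derivation d \<longleftrightarrow>
           (\<exists>b0. \<exists>k\<ge>1. k_commuting k (\<lambda>a. d a + b0 * a)))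
       \<and> (inner_derivation d \<longleftrightarrow>
           (\<exists>b0. \<exists>k\<ge>1. k_centralizing k (\<lambda>a. d a + b0 * a)))"
proof -
  have "x * a * b = x * b * a" for x a b :: 'a
  proof -
    have "x * (a * b - b * a) = 0"
      using assms(2) unfolding assms(1) rann_def by blast
    then show ?thesis by (simp add: right_diff_distrib mult.assoc)
  qed
  then have "\<exists>b. \<forall>k. k_commuting k (\<lambda>a. d a + b * a)" if "inner_derivation d"
    using that by (intro k_commuting_if_inner_derivation) auto
  moreover have "k_centralizing k T" if "k_commuting k T" for k and T :: "'a \<Rightarrow> 'a"
    using that by (simp add: k_commuting_def k_centralizing_def center_def)
  moreover have "inner_derivation d" if "k_centralizing k (\<lambda>a. d a + b * a)" for k b
    using assms that by (rule inner_derivation_if_k_centralizing)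
  \<comment> \<open>The passage from all \<open>k\<close> to some \<open>k\<close> uses
    \<open>k = 1\<close>.\<close>
  ultimately show ?thesis
    by (meson le_refl)
qed

end
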